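(* Let $\omega$ be an $\mathcal{A}_2$ weight on $\mathbb{D}$ and let $G\subset\mathbb{D}$ be a measurable set. If there exist $\delta\in(0,1)$ and $r\in(0,1)$ such that for all $a\in\mathbb{D}$ $$|G\cap S(a,r)|\ge\delta|S(a,r)|,$$ then there exists a positive constant $C=C(r,\delta)$ (for the given weight $\omega$) such that $$\int_{\mathbb{D}}|f(z)|^2\omega(z)\,dA(z)\le C\int_G|f(z)|^2\omega(z)\,dA(z)$$ for all $f\in L_h^2(\omega)$.
   Context: $\mathbb{D}$ is the open unit disk in $\mathbb{C}$, $dA$ is Lebesgue area measure on $\mathbb{D}$ normalized so that $\mathbb{D}$ has measure $1$, $|E|$ is the $dA$-measure of $E$, and $|E|_\omega=\int_E\omega\,dA$. A function $\omega$ with $0<\omega\in L^1(\mathbb{D},dA)$ is an $\mathcal{A}_2$ weight if $$[\omega]_{\mathcal{A}_2}:=\sup_{a\in\mathbb{D},\,0<r<1}\frac{|B(a,r)|_\omega\,|B(a,r)|_{\omega^{-1}}}{|B(a,r)|^2}<\infty,\qquad B(a,r)=\{z\in\mathbb{D}:|z-a|<r\}.$$ $L_h^2(\omega)$ is the space of complex-valued harmonic functions $f$ on $\mathbb{D}$ with $\int_{\mathbb{D}}|f|^2\omega\,dA<\infty$. For $a\in\mathbb{D}$, $0<r<1$, $S(a,r)=\{z\in\mathbb{D}:|z-a|<r(1-|a|)\}$. *)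

theory Defs
  imports "HOL-Analysis.Analysis"
begin

abbreviation unit_disk :: "complex set" where
  "unit_disk \<equiv> ball 0 1"

text \<open>Normalized area measure \<open>dA\<close>. Its space is the disk itself, so functions are
  tested for measurability on the disk only, and \<open>E \<in> sets disk_area\<close> says that \<open>E\<close> is a
  Lebesgue measurable subset of the disk.\<close>

definition disk_area :: "complex measure" where
  "disk_area = uniform_measure (lebesgue_on unit_disk) unit_disk"

definition weighted_area :: "(complex \<Rightarrow> real) \<Rightarrow> complex set \<Rightarrow> ennreal" where
  "weighted_area \<omega> E = (\<integral>\<^sup>+z\<in>E. ennreal (\<omega> z) \<partial>disk_area)"

text \<open>The paper's \<open>B(a,r)\<close> (which may be cut off by the boundary of the disk) and \<open>S(a,r)\<close>.\<close>

definition trace_ball :: "complex \<Rightarrow> real \<Rightarrow> complex set" where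
  "trace_ball a r = {z \<in> unit_disk. cmod (z - a) < r}"

definition whitney_disk :: "complex \<Rightarrow> real \<Rightarrow> complex set" where
  "whitney_disk a r = {z \<in> unit_disk. cmod (z - a) < r * (1 - cmod a)}"

text \<open>The characteristic takes values in \<^typ>\<open>ennreal\<close>, so that a divergent integral of
  \<open>\<omega>\<close> or \<open>1/\<omega>\<close> over some \<open>trace_ball a r\<close> makes it infinite.\<close>

definition A2_characteristic :: "(complex \<Rightarrow> real) \<Rightarrow> ennreal" where
  "A2_characteristic \<omega> =
     (SUP a\<in>unit_disk. SUP r\<in>{0<..<1}.
        weighted_area \<omega> (trace_ball a r) * weighted_area (\<lambda>z. inverse (\<omega> z)) (trace_ball a r)
          / (emeasure disk_area (trace_ball a r))\<^sup>2)"

text \<open>As an element of \<open>L\<^sup>1\<close>, the weight is only required to be positive almost everywhere.\<close>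

definition A2_weight :: "(complex \<Rightarrow> real) \<Rightarrow> bool" where
  "A2_weight \<omega> \<longleftrightarrow>
     integrable disk_area \<omega> \<and> (AE z in disk_area. 0 < \<omega> z) \<and> A2_characteristic \<omega> < \<infinity>"

text \<open>Complex-valued harmonic functions: twice continuously differentiable in the real sense
  with vanishing Laplacian. Here \<open>fx\<close>, \<open>fy\<close> are the first-order and \<open>fxx\<close>, \<open>fxy\<close>, \<open>fyx\<close>, \<open>fyy\<close>
  the second-order partial derivatives.\<close>

definition harmonic_on :: "(complex \<Rightarrow> complex) \<Rightarrow> complex set \<Rightarrow> bool" where
  "harmonic_on f U \<longleftrightarrow> open U \<and>
     (\<exists>fx fy fxx fxy fyx fyy.
        continuous_on U fxx \<and> continuous_on U fxy \<and> continuous_on U fyx \<and> continuous_on U fyy \<and>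
        (\<forall>z\<in>U.
           (f has_derivative (\<lambda>h. Re h *\<^sub>R fx z + Im h *\<^sub>R fy z)) (at z) \<and>
           (fx has_derivative (\<lambda>h. Re h *\<^sub>R fxx z + Im h *\<^sub>R fxy z)) (at z) \<and>
           (fy has_derivative (\<lambda>h. Re h *\<^sub>R fyx z + Im h *\<^sub>R fyy z)) (at z) \<and>
           fxx z + fyy z = 0))"

definition L2h :: "(complex \<Rightarrow> real) \<Rightarrow> (complex \<Rightarrow> complex) set" where
  "L2h \<omega> = {f. harmonic_on f unit_disk \<and>
     (\<integral>\<^sup>+z. ennreal ((cmod (f z))\<^sup>2 * \<omega> z) \<partial>disk_area) < \<infinity>}"

end

theory Submission
  imports Defs "HOL-Complex_Analysis.Complex_Analysis"
begin

text \<open>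
  Let \<open>S = S(a,r)\<close> and let \<open>T = S(a,\<rho>)\<close> with \<open>r < \<rho> < 1\<close>, and let \<open>F = |f|\<^sup>2 \<omega>\<close>. The mean value property,
  the Cauchy--Schwarz inequality and the \<open>A\<^sub>2\<close> condition bound \<open>|f|\<^sup>2\<close> on a disk between \<open>S\<close> and
  \<open>T\<close> by a multiple of the weighted mean of \<open>F\<close> over \<open>T\<close>. So if \<open>\<epsilon> \<integral>\<^sub>T F < \<integral>\<^sub>S F\<close>, then \<open>|f|\<close> there is at
  most a constant times its supremum \<open>m\<close> over \<open>S\<close>, and by compactness \<open>|f| \<ge> \<eta> m\<close> outside a small
  proportion of \<open>S\<close>, with \<open>\<eta>\<close> independent of \<open>f\<close> and \<open>a\<close>. As the \<open>A\<^sub>2\<close> condition turns a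
  proportion of area into a proportion of weighted area, \<open>\<integral>\<^sub>S F \<le> C \<integral> F\<close> over \<open>G \<inter> S\<close>. In every case
  \<open>\<integral>\<^sub>S F\<close> is at most \<open>\<epsilon> \<integral>\<^sub>T F\<close> plus that multiple of the integral over \<open>G \<inter> S\<close>. Integrate this
  over \<open>a\<close> with respect to \<open>(1 - |a|)\<^sup>-\<^sup>2 dA(a)\<close>: by Tonelli's theorem all terms become comparable to
  \<open>\<integral>F\<close> or \<open>\<integral>F\<close> over \<open>G\<close>, and for small \<open>\<epsilon>\<close> the first term on the right is absorbed.
\<close>

section \<open>The area mean value property of holomorphic functions\<close>

unbundle no fps_syntax

text \<open>The identification of the two planes pulls a box back to a box with the same sides, and
  boxes determine \<open>lborel\<close>. This carries the invariance under orthogonal maps of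
  \<open>real^2\<close> over to \<open>complex\<close>.\<close>

lemma lborel_complex_eq_distr_real2:
  "(lborel :: complex measure) = distr (lborel :: (real^2) measure) borel (\<lambda>v. Complex (v $ 1) (v $ 2))"
proof (rule lborel_eqI)
  let ?\<psi> = "\<lambda>v::real^2. Complex (v $ 1) (v $ 2)"
  have meas: "?\<psi> \<in> borel_measurable borel"
    by (intro borel_measurable_continuous_onI)
       (auto intro!: continuous_intros simp: Complex_eq)
  fix l u :: complex
  assume le: "\<And>b. b \<in> Basis \<Longrightarrow> l \<bullet> b \<le> u \<bullet> b"
  have le': "Re l \<le> Re u" "Im l \<le> Im u"
    using le[of 1] le[of \<i>] by (auto simp: Basis_complex_def inner_complex_def)
  have basis: "(Basis :: (real^2) set) = {axis 1 1, axis 2 1}"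
    by (auto simp: Basis_vec_def) (metis exhaust_2)
  have vim: "?\<psi> -` box l u = box (vector [Re l, Im l]) (vector [Re u, Im u])"
    by (auto simp: box_def Basis_complex_def inner_complex_def basis inner_axis vector_2)
  have "emeasure (distr lborel borel ?\<psi>) (box l u) = emeasure lborel (?\<psi> -` box l u)"
    using meas by (subst emeasure_distr) auto
  also have "\<dots> = ennreal (\<Prod>b\<in>(Basis :: (real^2) set). (vector [Re u, Im u] - vector [Re l, Im l]) \<bullet> b)"
    unfolding vim
  proof (rule emeasure_lborel_box)
    fix b :: "real^2" assume "b \<in> Basis"
    then show "vector [Re l, Im l] \<bullet> b \<le> vector [Re u, Im u] \<bullet> b"
      using le' by (auto simp: basis inner_axis vector_2)
  qed
  also have "(\<Prod>b\<in>(Basis :: (real^2) set). (vector [Re u, Im u] - vector [Re l, Im l]) \<bullet> b)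
      = (\<Prod>b\<in>Basis. (u - l) \<bullet> b)"
  proof -
    have "(axis 1 1 :: real^2) \<noteq> axis 2 1"
      by (simp add: axis_eq_axis)
    then show ?thesis
      by (simp add: basis Basis_complex_def inner_complex_def inner_axis vector_2)
  qed
  finally show "emeasure (distr lborel borel ?\<psi>) (box l u) = ennreal (\<Prod>b\<in>Basis. (u - l) \<bullet> b)" .
qed simp

text \<open>The preimage of a box is its image under \<open>inv T\<close>, which is again orthogonal
  and so preserves Lebesgue measure; boxes suffice to identify the measure.\<close>

lemma lborel_distr_orthogonal:
  fixes T :: "real^'n::{finite,wellorder} \<Rightarrow> real^'n::_"
  assumes T: "orthogonal_transformation T"
  shows "distr lborel borel T = lborel"
proof (rule lborel_eqI[symmetric])
  have lin: "linear T" and bij: "bij T"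
    using T orthogonal_transformation_linear orthogonal_transformation_bij by blast+
  have meas: "T \<in> borel_measurable borel"
    using lin by (intro borel_measurable_continuous_onI linear_continuous_on)
      (simp add: linear_conv_bounded_linear)
  have inv: "orthogonal_transformation (inv T)"
    using T by (rule orthogonal_transformation_inv)
  fix l u :: "real^'n::{finite,wellorder}"
  assume le: "\<And>b. b \<in> Basis \<Longrightarrow> l \<bullet> b \<le> u \<bullet> b"
  have img: "T -` box l u = inv T ` box l u"
    using bij by (simp add: bij_vimage_eq_inv_image)
  have lm: "inv T ` box l u \<in> lmeasurable"
    by (intro measurable_orthogonal_image inv lmeasurable_box)
  have "emeasure (distr lborel borel T) (box l u) = emeasure lborel (T -` box l u)"
    using meas by (subst emeasure_distr) auto
  also have "\<dots> = emeasure lebesgue (T -` box l u)"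
    using measurable_sets[OF meas, of "box l u"] by (simp add: space_borel)
  also have "\<dots> = ennreal (measure lebesgue (inv T ` box l u))"
    unfolding img using fmeasurableD2[OF lm] by (rule emeasure_eq_ennreal_measure)
  also have "\<dots> = ennreal (measure lebesgue (box l u))"
    by (simp add: measure_orthogonal_image[OF inv])
  also have "\<dots> = ennreal (\<Prod>b\<in>Basis. (u - l) \<bullet> b)"
    using le by (simp add: measure_lborel_box)
  finally show "emeasure (distr lborel borel T) (box l u) = ennreal (\<Prod>b\<in>Basis. (u - l) \<bullet> b)" .
qed simp

text \<open>In real coordinates, multiplication by \<open>c\<close> is the linear map
  \<open>?T\<close>, which is orthogonal because \<open>cmod c = 1\<close>.\<close>

lemma lborel_distr_rotation:
  fixes c :: complex
  assumes c: "cmod c = 1"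
  shows "distr lborel borel ((*) c) = lborel"
proof -
  let ?\<psi> = "\<lambda>v::real^2. Complex (v $ 1) (v $ 2)"
  let ?T = "\<lambda>v::real^2. vector [Re c * v$1 - Im c * v$2, Re c * v$2 + Im c * v$1] :: real^2"
  have c2: "(Re c)\<^sup>2 + (Im c)\<^sup>2 = 1"
    using c by (simp add: cmod_def)
  have \<psi>: "?\<psi> \<in> borel_measurable borel"
    by (intro borel_measurable_continuous_onI)
       (auto intro!: continuous_intros simp: Complex_eq)
  have lin: "linear ?T"
    by (intro linearI) (auto simp: vec_eq_iff forall_2 vector_2 algebra_simps)
  have orth: "orthogonal_transformation ?T"
  proof -
    have "?T v \<bullet> ?T w = v \<bullet> w" for v w :: "real^2"
    proof -
      have "?T v \<bullet> ?T w = ((Re c)\<^sup>2 + (Im c)\<^sup>2) * (v$1 * w$1 + v$2 * w$2)"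
        by (simp add: inner_vec_def sum_2 vector_2 power2_eq_square algebra_simps)
      then show ?thesis by (simp add: c2 inner_vec_def sum_2)
    qed
    with lin show ?thesis by (simp add: orthogonal_transformation_def)
  qed
  have T: "?T \<in> borel_measurable borel"
    using lin by (intro borel_measurable_continuous_onI linear_continuous_on)
      (simp add: linear_conv_bounded_linear)
  have "distr lborel borel ((*) c) = distr (distr lborel borel ?\<psi>) borel ((*) c)"
    by (simp flip: lborel_complex_eq_distr_real2)
  also have "\<dots> = distr lborel borel ((*) c \<circ> ?\<psi>)"
    using \<psi> by (intro distr_distr) auto
  also have "(*) c \<circ> ?\<psi> = ?\<psi> \<circ> ?T"
    by (auto simp: fun_eq_iff complex_eq_iff vector_2)
  also have "distr lborel borel (?\<psi> \<circ> ?T) = distr (distr lborel borel ?T) borel ?\<psi>"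
    using \<psi> T by (intro distr_distr[symmetric]) auto
  also have "\<dots> = lborel"
    by (simp add: lborel_distr_orthogonal[OF orth] flip: lborel_complex_eq_distr_real2)
  finally show ?thesis .
qed

text \<open>A rotation by \<open>c\<close> with \<open>c ^ n = -1\<close> preserves the disk and the
  measure but changes the sign of the integrand, so the integral equals its own negative.\<close>

lemma set_integral_power_ball_eq_0:
  assumes n: "n > 0"
  shows "(LINT w:ball (0::complex) s|lborel. w ^ n) = 0"
proof -
  define c where "c = cis (pi / n)"
  have c: "cmod c = 1" "c ^ n = -1"
    using n by (auto simp: c_def Complex.DeMoivre)
  let ?g = "\<lambda>w::complex. indicat_real (ball 0 s) w *\<^sub>R w ^ n"
  have g: "?g \<in> borel_measurable borel"
    by (intro borel_measurable_scaleR borel_measurable_power borel_measurable_indicator) auto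
  have "(\<integral>w. ?g w \<partial>lborel) = (\<integral>w. ?g w \<partial>distr lborel borel ((*) c))"
    by (simp add: lborel_distr_rotation c)
  also have "\<dots> = (\<integral>w. ?g (c * w) \<partial>lborel)"
    using g by (intro integral_distr) auto
  also have "\<dots> = (\<integral>w. - ?g w \<partial>lborel)"
    by (intro Bochner_Integration.integral_cong)
       (auto simp: norm_mult c power_mult_distrib indicator_def)
  also have "\<dots> = - (\<integral>w. ?g w \<partial>lborel)"
    by simp
  finally have "2 * (\<integral>w. ?g w \<partial>lborel) = 0" by (simp add: eq_neg_iff_add_eq_0)
  then show ?thesis by (simp add: set_lebesgue_integral_def)
qed

lemma emeasure_lborel_ball_complex:
  "s \<ge> 0 \<Longrightarrow> emeasure lborel (ball (a::complex) s) = ennreal (pi * s\<^sup>2)"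
  by (simp add: emeasure_ball unit_ball_vol_2)

lemma measure_lborel_ball_complex:
  "s \<ge> 0 \<Longrightarrow> measure lborel (ball (a::complex) s) = pi * s\<^sup>2"
  by (simp add: measure_def emeasure_lborel_ball_complex)

text \<open>The power series at the centre is integrated term by term, and by rotation invariance
  only the constant term survives.\<close>

lemma holomorphic_area_mean_value_0:
  assumes h: "h holomorphic_on ball 0 R" and s: "0 < s" "s < R"
  shows "(LINT w:ball 0 s|lborel. h w) = of_real (pi * s\<^sup>2) * h 0"
proof -
  define a where "a n = (deriv ^^ n) h 0 / fact n" for n
  have sums: "(\<lambda>n. a n * w ^ n) sums h w" if "w \<in> ball 0 R" for w
    using holomorphic_power_series[OF h that] by (simp add: a_def)
  \<comment> \<open>Convergence at the larger radius \<open>t\<close> gives absolute convergence at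
    radius \<open>s\<close>, and the terms there dominate the series on the whole disk.\<close>
  obtain t where t: "s < t" "t < R" using s dense by blast
  have "summable (\<lambda>n. a n * of_real t ^ n)"
    using sums[of "of_real t"] s t by (simp add: sums_iff)
  then have abs: "summable (\<lambda>n. norm (a n * of_real s ^ n))"
    by (rule powser_insidea) (use s t in auto)
  let ?f = "\<lambda>n w. indicat_real (ball 0 s) w *\<^sub>R (a n * w ^ n)"
  have le: "norm (?f n w) \<le> norm (a n * of_real s ^ n) * indicat_real (ball 0 s) w" for n w
    using s by (auto simp: indicator_def norm_mult norm_power intro!: mult_left_mono power_mono)
  have int_ind: "integrable lborel (\<lambda>w. c * indicat_real (ball (0::complex) s) w)" for c :: real
    using s by (intro integrable_mult_right) (simp add: integrable_indicator_iff emeasure_lborel_ball_complex)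
  have int: "integrable lborel (?f n)" for n
  proof (rule Bochner_Integration.integrable_bound[OF int_ind[of "norm (a n * of_real s ^ n)"]])
    show "?f n \<in> borel_measurable lborel"
      by (intro borel_measurable_scaleR borel_measurable_times borel_measurable_power
          borel_measurable_indicator) auto
    show "AE w in lborel. norm (?f n w) \<le> norm (norm (a n * of_real s ^ n) * indicat_real (ball 0 s) w)"
      using le by (intro AE_I2 order.trans[OF le]) simp
  qed
  have "(\<integral>w. (\<Sum>n. ?f n w) \<partial>lborel) = (\<Sum>n. \<integral>w. ?f n w \<partial>lborel)"
  proof (rule integral_suminf[OF int])
    show "AE w in lborel. summable (\<lambda>n. norm (?f n w))"
      using le by (intro AE_I2 summable_comparison_test'[OF summable_mult2[OF abs]]) auto
    show "summable (\<lambda>n. \<integral>w. norm (?f n w) \<partial>lborel)"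
    proof (rule summable_comparison_test'[OF summable_mult2[OF abs, of "pi * s\<^sup>2"], where N = 0])
      fix n
      have "(\<integral>w. norm (?f n w) \<partial>lborel) \<le> (\<integral>w. norm (a n * of_real s ^ n) * indicat_real (ball (0::complex) s) w \<partial>lborel)"
        by (intro Bochner_Integration.integral_mono integrable_norm[OF int] int_ind) (rule le)
      also have "\<dots> = norm (a n * of_real s ^ n) * (pi * s\<^sup>2)"
        using s by (simp add: measure_lborel_ball_complex)
      finally show "norm (\<integral>w. norm (?f n w) \<partial>lborel) \<le> norm (a n * of_real s ^ n) * (pi * s\<^sup>2)"
        by (simp add: abs_of_nonneg)
    qed
  qed
  also have "(\<lambda>n. \<integral>w. ?f n w \<partial>lborel) = (\<lambda>n. if n = 0 then of_real (pi * s\<^sup>2) * h 0 else 0)"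
  proof
    fix n
    have "(\<integral>w. ?f n w \<partial>lborel) = a n * (LINT w:ball 0 s|lborel. w ^ n)"
      by (simp add: set_lebesgue_integral_def flip: mult_scaleR_right)
    also have "\<dots> = (if n = 0 then of_real (pi * s\<^sup>2) * h 0 else 0)"
    proof (cases "n = 0")
      case True
      then show ?thesis
        using s by (simp add: a_def set_lebesgue_integral_def measure_lborel_ball_complex
            emeasure_lborel_ball_complex scaleR_conv_of_real)
    qed (simp add: set_integral_power_ball_eq_0)
    finally show "(\<integral>w. ?f n w \<partial>lborel) = (if n = 0 then of_real (pi * s\<^sup>2) * h 0 else 0)" .
  qed
  also have "(\<Sum>n. if n = 0 then of_real (pi * s\<^sup>2) * h 0 else 0) = of_real (pi * s\<^sup>2) * h 0"
    using sums_single[of 0 "\<lambda>_. of_real (pi * s\<^sup>2) * h 0"] by (simp add: sums_iff)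
  also have "(\<integral>w. (\<Sum>n. ?f n w) \<partial>lborel) = (LINT w:ball 0 s|lborel. h w)"
    unfolding set_lebesgue_integral_def
  proof (intro Bochner_Integration.integral_cong refl)
    fix w
    show "(\<Sum>n. ?f n w) = indicat_real (ball 0 s) w *\<^sub>R h w"
      using sums[of w] s by (auto simp: indicator_def sums_iff)
  qed
  finally show ?thesis .
qed

lemma holomorphic_area_mean_value:
  assumes h: "h holomorphic_on ball z R" and s: "0 < s" "s < R"
  shows "(LINT w:ball z s|lborel. h w) = of_real (pi * s\<^sup>2) * h z"
proof -
  have "(\<lambda>w. h (z + w)) holomorphic_on ball 0 R"
    by (rule holomorphic_on_compose_gen[OF _ h, unfolded o_def]) (auto intro!: holomorphic_intros simp: dist_norm)
  from holomorphic_area_mean_value_0[OF this s]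
  have "(LINT w:ball 0 s|lborel. h (z + w)) = of_real (pi * s\<^sup>2) * h z" by simp
  moreover have "(LINT w:ball z s|lborel. h w) = (LINT w:ball 0 s|lborel. h (z + w))"
  proof -
    have "(\<lambda>w. indicat_real (ball z s) w *\<^sub>R h w) \<in> borel_measurable borel"
      using s by (intro borel_measurable_continuous_on_indicator
          holomorphic_on_imp_continuous_on holomorphic_on_subset[OF h]) auto
    then have "(\<integral>w. indicat_real (ball z s) w *\<^sub>R h w \<partial>distr lborel borel ((+) z)) =
        (\<integral>w. indicat_real (ball z s) (z + w) *\<^sub>R h (z + w) \<partial>lborel)"
      by (intro integral_distr) auto
    then show ?thesis
      by (simp add: set_lebesgue_integral_def lborel_distr_plus indicator_def dist_norm)
  qed
  ultimately show ?thesis by simp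
qed

section \<open>Harmonic functions as real parts of holomorphic functions\<close>

text \<open>Along horizontal lines, and in the next lemma along vertical ones, partial derivatives
  become derivatives in one real variable, to which the mean value theorem applies.\<close>

lemma has_derivative_partial_Re:
  fixes f :: "complex \<Rightarrow> real"
  assumes "(f has_derivative (\<lambda>h. Re h *\<^sub>R a + Im h *\<^sub>R b)) (at (z + of_real t))"
  shows "((\<lambda>t. f (z + of_real t)) has_real_derivative a) (at t)"
proof -
  have "((\<lambda>t. z + of_real t) has_derivative (\<lambda>h. of_real h)) (at t)"
    by (auto intro!: derivative_eq_intros)
  from has_derivative_compose[OF this assms] show ?thesis
    by (auto simp: has_field_derivative_def mult.commute elim!: has_derivative_eq_rhs)
qed

lemma has_derivative_partial_Im:
  fixes f :: "complex \<Rightarrow> real"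
  assumes "(f has_derivative (\<lambda>h. Re h *\<^sub>R a + Im h *\<^sub>R b)) (at (z + of_real t * \<i>))"
  shows "((\<lambda>t. f (z + of_real t * \<i>)) has_real_derivative b) (at t)"
proof -
  have "((\<lambda>t. z + of_real t * \<i>) has_derivative (\<lambda>h. of_real h * \<i>)) (at t)"
    by (auto intro!: derivative_eq_intros)
  from has_derivative_compose[OF this assms] show ?thesis
    by (auto simp: has_field_derivative_def mult.commute elim!: has_derivative_eq_rhs)
qed

text \<open>The mixed second difference of \<open>u\<close> over a square of side \<open>t\<close> is \<open>t\<^sup>2\<close> times a value of
  either mixed partial derivative.\<close>

lemma mixed_partials_eq:
  fixes u ux uy uxx uxy uyx uyy :: "complex \<Rightarrow> real"
  assumes U: "open U" "z \<in> U"
    and cont: "continuous_on U uxy" "continuous_on U uyx"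
    and u: "\<And>z. z \<in> U \<Longrightarrow> (u has_derivative (\<lambda>h. Re h *\<^sub>R ux z + Im h *\<^sub>R uy z)) (at z)"
    and ux: "\<And>z. z \<in> U \<Longrightarrow> (ux has_derivative (\<lambda>h. Re h *\<^sub>R uxx z + Im h *\<^sub>R uxy z)) (at z)"
    and uy: "\<And>z. z \<in> U \<Longrightarrow> (uy has_derivative (\<lambda>h. Re h *\<^sub>R uyx z + Im h *\<^sub>R uyy z)) (at z)"
  shows "uxy z = uyx z"
proof -
  have "\<bar>uxy z - uyx z\<bar> \<le> 2 * e" if e: "e > 0" for e
  proof -
    obtain d1 where d1: "d1 > 0" "ball z d1 \<subseteq> U" using U openE by blast
    obtain d2 where d2: "d2 > 0" "\<And>w. w \<in> U \<Longrightarrow> dist w z < d2 \<Longrightarrow> dist (uxy w) (uxy z) < e"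
      using cont(1) U(2) e by (force simp: continuous_on_iff)
    obtain d3 where d3: "d3 > 0" "\<And>w. w \<in> U \<Longrightarrow> dist w z < d3 \<Longrightarrow> dist (uyx w) (uyx z) < e"
      using cont(2) U(2) e by (force simp: continuous_on_iff)
    \<comment> \<open>Points of the square with corner \<open>z\<close> and side \<open>t\<close>
      are within \<open>2 * t\<close> of \<open>z\<close>, so a third of the least radius keeps the
      square in \<open>U\<close> and both mixed partials within \<open>e\<close> of their values at
      \<open>z\<close>.\<close>
    define t where "t = min d1 (min d2 d3) / 3"
    have t: "0 < t" "2 * t < d1" "2 * t < d2" "2 * t < d3"
      using d1 d2 d3 by (auto simp: t_def)
    have nrm: "cmod (of_real s + of_real s' * \<i>) \<le> 2 * t" if "0 \<le> s" "s \<le> t" "0 \<le> s'" "s' \<le> t" for s s'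
      using norm_triangle_ineq[of "of_real s" "of_real s' * \<i>"] that by (simp add: norm_mult)
    have inU: "z + of_real s + of_real s' * \<i> \<in> U" if "0 \<le> s" "s \<le> t" "0 \<le> s'" "s' \<le> t" for s s'
      using nrm[OF that] t d1(2) by (auto simp: dist_norm subset_iff norm_minus_commute add.assoc)
    have inU': "z + of_real s' * \<i> + of_real s \<in> U" if "0 \<le> s" "s \<le> t" "0 \<le> s'" "s' \<le> t" for s s'
      using inU[OF that] by (simp add: algebra_simps)
    have near: "dist (z + of_real s + of_real s' * \<i>) z \<le> 2 * t" if "0 \<le> s" "s \<le> t" "0 \<le> s'" "s' \<le> t" for s s'
      using nrm[OF that] by (simp add: dist_norm add.assoc)
    define \<Delta> where "\<Delta> = u (z + of_real t + of_real t * \<i>) - u (z + of_real t)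
        - (u (z + of_real t * \<i>) - u z)"
    \<comment> \<open>The mean value theorem, applied first horizontally and then vertically, turns
      \<open>\<Delta>\<close> into a multiple of a value of \<open>uxy\<close>; the opposite order
      below gives one of \<open>uyx\<close>.\<close>
    have "\<exists>s. 0 < s \<and> s < t \<and>
        (u (z + of_real t * \<i> + of_real t) - u (z + of_real t)) - (u (z + of_real t * \<i> + of_real 0) - u (z + of_real 0))
        = (t - 0) * (ux (z + of_real t * \<i> + of_real s) - ux (z + of_real s))"
      using inU'[of _ t] inU'[of _ 0] t
      by (intro MVT2 DERIV_diff has_derivative_partial_Re[OF u]) auto
    then obtain s where s: "0 < s" "s < t"
      "\<Delta> = t * (ux (z + of_real s + of_real t * \<i>) - ux (z + of_real s))"
      by (auto simp: \<Delta>_def algebra_simps)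
    have "\<exists>s'. 0 < s' \<and> s' < t \<and>
        ux (z + of_real s + of_real t * \<i>) - ux (z + of_real s + of_real 0 * \<i>)
        = (t - 0) * uxy (z + of_real s + of_real s' * \<i>)"
      using inU[of s] t s
      by (intro MVT2 has_derivative_partial_Im[OF ux]) auto
    then obtain s' where s': "0 < s'" "s' < t" "\<Delta> = t * t * uxy (z + of_real s + of_real s' * \<i>)"
      using s by auto
    have "\<exists>s. 0 < s \<and> s < t \<and>
        (u (z + of_real t + of_real t * \<i>) - u (z + of_real t * \<i>)) - (u (z + of_real t + of_real 0 * \<i>) - u (z + of_real 0 * \<i>))
        = (t - 0) * (uy (z + of_real t + of_real s * \<i>) - uy (z + of_real s * \<i>))"
      using inU[of t] inU[of 0] t
      by (intro MVT2 DERIV_diff has_derivative_partial_Im[OF u]) auto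
    then obtain p where p: "0 < p" "p < t"
      "\<Delta> = t * (uy (z + of_real p * \<i> + of_real t) - uy (z + of_real p * \<i>))"
      by (auto simp: \<Delta>_def algebra_simps)
    have "\<exists>p'. 0 < p' \<and> p' < t \<and>
        uy (z + of_real p * \<i> + of_real t) - uy (z + of_real p * \<i> + of_real 0)
        = (t - 0) * uyx (z + of_real p * \<i> + of_real p')"
      using inU'[of _ p] t p
      by (intro MVT2 has_derivative_partial_Re[OF uy]) auto
    then obtain p' where p': "0 < p'" "p' < t" "\<Delta> = t * t * uyx (z + of_real p' + of_real p * \<i>)"
      using p by (auto simp: algebra_simps)
    have eq: "uxy (z + of_real s + of_real s' * \<i>) = uyx (z + of_real p' + of_real p * \<i>)"
      using s'(3) p'(3) t by simp
    have "dist (uxy (z + of_real s + of_real s' * \<i>)) (uxy z) < e"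
      using near[of s s'] inU[of s s'] s s' t by (intro d2) auto
    moreover have "dist (uyx (z + of_real p' + of_real p * \<i>)) (uyx z) < e"
      using near[of p' p] inU[of p' p] p p' t by (intro d3) auto
    ultimately show ?thesis using eq by (simp add: dist_real_def)
  qed
  \<comment> \<open>For this \<open>e\<close>, a non-zero difference would be at most half of its
    own size.\<close>
  from this[of "\<bar>uxy z - uyx z\<bar> / 4"] show ?thesis by (cases "uxy z = uyx z") auto
qed

text \<open>Needed for the factor \<open>- \<i>\<close>, which makes the imaginary part of a
  harmonic function the real part of another one.\<close>

lemma harmonic_on_cmult:
  assumes "harmonic_on f U"
  shows "harmonic_on (\<lambda>z. c * f z) U"
proof -
  from assms obtain fx fy fxx fxy fyx fyy where U: "open U"
    and c: "continuous_on U fxx" "continuous_on U fxy" "continuous_on U fyx" "continuous_on U fyy"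
    and d: "\<And>z. z \<in> U \<Longrightarrow> (f has_derivative (\<lambda>h. Re h *\<^sub>R fx z + Im h *\<^sub>R fy z)) (at z)"
      "\<And>z. z \<in> U \<Longrightarrow> (fx has_derivative (\<lambda>h. Re h *\<^sub>R fxx z + Im h *\<^sub>R fxy z)) (at z)"
      "\<And>z. z \<in> U \<Longrightarrow> (fy has_derivative (\<lambda>h. Re h *\<^sub>R fyx z + Im h *\<^sub>R fyy z)) (at z)"
      "\<And>z. z \<in> U \<Longrightarrow> fxx z + fyy z = 0"
    unfolding harmonic_on_def by blast
  have *: "((\<lambda>z. c * g z) has_derivative (\<lambda>h. Re h *\<^sub>R (c * a) + Im h *\<^sub>R (c * b))) (at z)"
    if "(g has_derivative (\<lambda>h. Re h *\<^sub>R a + Im h *\<^sub>R b)) (at z)" for g a b z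
    using has_derivative_mult_right[OF that, of c] by (simp add: algebra_simps)
  show ?thesis
    unfolding harmonic_on_def
    by (rule conjI[OF U], rule exI[of _ "\<lambda>z. c * fx z"], rule exI[of _ "\<lambda>z. c * fy z"],
        rule exI[of _ "\<lambda>z. c * fxx z"], rule exI[of _ "\<lambda>z. c * fxy z"],
        rule exI[of _ "\<lambda>z. c * fyx z"], rule exI[of _ "\<lambda>z. c * fyy z"])
       (use c d in \<open>auto intro!: continuous_intros * simp flip: distrib_left\<close>)
qed

lemma harmonic_on_imp_continuous_on:
  assumes "harmonic_on f U"
  shows "continuous_on U f"
proof -
  from assms obtain fx fy where
    "\<And>z. z \<in> U \<Longrightarrow> (f has_derivative (\<lambda>h. Re h *\<^sub>R fx z + Im h *\<^sub>R fy z)) (at z)"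
    unfolding harmonic_on_def by blast
  then show ?thesis
    by (meson continuous_at_imp_continuous_on has_derivative_continuous)
qed

text \<open>With \<open>u = Re f\<close>, the function \<open>u\<^sub>x - i u\<^sub>y\<close> is holomorphic, and \<open>u\<close> is up to a constant the
  real part of its primitive.\<close>

lemma harmonic_on_imp_Re_holomorphic:
  assumes f: "harmonic_on f U" and U: "convex U"
  obtains h where "h holomorphic_on U" "\<And>z. z \<in> U \<Longrightarrow> Re (h z) = Re (f z)"
proof -
  from f obtain fx fy fxx fxy fyx fyy where open_U: "open U"
    and c: "continuous_on U fxx" "continuous_on U fxy" "continuous_on U fyx" "continuous_on U fyy"
    and d: "\<And>z. z \<in> U \<Longrightarrow> (f has_derivative (\<lambda>h. Re h *\<^sub>R fx z + Im h *\<^sub>R fy z)) (at z)"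
      "\<And>z. z \<in> U \<Longrightarrow> (fx has_derivative (\<lambda>h. Re h *\<^sub>R fxx z + Im h *\<^sub>R fxy z)) (at z)"
      "\<And>z. z \<in> U \<Longrightarrow> (fy has_derivative (\<lambda>h. Re h *\<^sub>R fyx z + Im h *\<^sub>R fyy z)) (at z)"
      "\<And>z. z \<in> U \<Longrightarrow> fxx z + fyy z = 0"
    unfolding harmonic_on_def by blast
  have dRe: "((\<lambda>z. Re (g z)) has_derivative (\<lambda>h. Re h *\<^sub>R Re a + Im h *\<^sub>R Re b)) (at z)"
    if "(g has_derivative (\<lambda>h. Re h *\<^sub>R a + Im h *\<^sub>R b)) (at z)" for g a b z
    using has_derivative_Re[OF that] by simp
  have sym: "Re (fxy z) = Re (fyx z)" if "z \<in> U" for z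
    by (rule mixed_partials_eq[OF open_U that continuous_on_Re[OF c(2)] continuous_on_Re[OF c(3)]
          dRe[OF d(1)] dRe[OF d(2)] dRe[OF d(3)]])
  define g where "g z = of_real (Re (fx z)) - \<i> * of_real (Re (fy z))" for z
  have "(g has_field_derivative (of_real (Re (fxx z)) - \<i> * of_real (Re (fyx z)))) (at z)" if z: "z \<in> U" for z
  proof -
    have "(g has_derivative (\<lambda>h. of_real (Re h *\<^sub>R Re (fxx z) + Im h *\<^sub>R Re (fxy z)) -
        \<i> * of_real (Re h *\<^sub>R Re (fyx z) + Im h *\<^sub>R Re (fyy z)))) (at z)"
      unfolding g_def
      by (rule has_derivative_diff[OF has_derivative_of_real[OF dRe[OF d(2)[OF z]]]
            has_derivative_mult_right[OF has_derivative_of_real[OF dRe[OF d(3)[OF z]]]]])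
    moreover have "Re (fyy z) = - Re (fxx z)"
      using arg_cong[OF d(4)[OF z], of Re] by simp
    \<comment> \<open>The vanishing Laplacian and the symmetry of the mixed partials are the
      Cauchy--Riemann equations for \<open>g\<close>, so its real derivative is complex
      linear.\<close>
    ultimately show ?thesis
      unfolding has_field_derivative_def
      by (elim has_derivative_eq_rhs) (simp add: fun_eq_iff complex_eq_iff sym[OF z] algebra_simps)
  qed
  then have "g holomorphic_on U"
    using open_U by (auto simp: holomorphic_on_open)
  then obtain H where H: "\<And>x. x \<in> U \<Longrightarrow> (H has_field_derivative g x) (at x within U)"
    by (rule holomorphic_convex_primitive'[OF U open_U]) (rule that, blast)
  have H': "(H has_field_derivative g x) (at x)" if "x \<in> U" for x
    using H[OF that] by (simp only: at_within_open[OF that open_U])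
  have der0: "((\<lambda>z. Re (H z) - Re (f z)) has_derivative (\<lambda>h. 0)) (at z)" if z: "z \<in> U" for z
  proof -
    have "((\<lambda>z. Re (H z) - Re (f z)) has_derivative
        (\<lambda>h. Re (g z * h) - (Re h *\<^sub>R Re (fx z) + Im h *\<^sub>R Re (fy z)))) (at z)"
      by (rule has_derivative_diff[OF has_derivative_Re[OF H'[OF z, unfolded has_field_derivative_def]]
            dRe[OF d(1)[OF z]]])
    then show ?thesis
      by (rule has_derivative_eq_rhs) (simp add: fun_eq_iff g_def algebra_simps)
  qed
  have "\<exists>k. \<forall>z\<in>U. Re (H z) - Re (f z) = k"
    by (rule has_derivative_zero_constant[OF U has_derivative_at_withinI[OF der0]])
  then obtain k where k: "\<And>z. z \<in> U \<Longrightarrow> Re (H z) - Re (f z) = k" by blast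
  show ?thesis
  proof (rule that[of "\<lambda>z. H z - of_real k"])
    have "H holomorphic_on U" using H' open_U by (auto simp: holomorphic_on_open)
    then show "(\<lambda>z. H z - of_real k) holomorphic_on U" by (intro holomorphic_intros)
    show "Re (H z - of_real k) = Re (f z)" if "z \<in> U" for z using k[OF that] by simp
  qed
qed

section \<open>Sublevel sets\<close>

text \<open>The derivative has only countably many zeros. Near every other point \<open>h\<close> is
  injective with a holomorphic inverse, which maps null sets to null sets, and negligibility is a
  local property.\<close>

lemma negligible_holomorphic_vimage:
  assumes h: "h holomorphic_on U" and U: "open U" "connected U" and nc: "\<not> h constant_on U"
    and S: "negligible S"
  shows "negligible {z \<in> U. h z \<in> S}"
proof -
  have dh: "deriv h holomorphic_on U"
    using h U(1) by (rule holomorphic_deriv)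
  have "countable {z \<in> U. deriv h z = 0}"
  proof (cases "deriv h constant_on U")
    \<comment> \<open>A constant \<open>deriv h\<close> falls outside the theorem on countable
      zeros. Its value is non-zero because \<open>h\<close> is not constant, so there are no zeros
      at all.\<close>
    case True
    then obtain c where c: "\<And>z. z \<in> U \<Longrightarrow> deriv h z = c" by (auto simp: constant_on_def)
    have "c \<noteq> 0"
    proof
      assume "c = 0"
      then have "h constant_on U"
        using holomorphic_derivI[OF h U(1)] c U
        by (intro has_field_derivative_0_imp_constant_on) (metis, auto)
      with nc show False by simp
    qed
    then have "{z \<in> U. deriv h z = 0} = {}" using c by auto
    then show ?thesis by (simp only: countable_empty)
  next
    case False
    have "fsigma U"
      using open_Union_compact_subsets[OF U(1)]
      by (metis fsigma_Union_compact image_subset_iff mem_Collect_eq)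
    with False show ?thesis
      by (intro holomorphic_countable_zeros dh U)
  qed
  then have "negligible {z \<in> U. deriv h z = 0}"
    by (simp add: negligible_iff_null_sets countable_imp_null_set_lborel null_sets_completionI)
  moreover have "negligible {z \<in> U. deriv h z \<noteq> 0 \<and> h z \<in> S}" (is "negligible ?P")
    unfolding locally_negligible_alt[of ?P]
  proof
    fix x assume x: "x \<in> ?P"
    then obtain r where r: "r > 0" "ball x r \<subseteq> U" "inj_on h (ball x r)"
      using has_complex_derivative_locally_injective[OF h _ U(1)] by blast
    have "h holomorphic_on ball x r" using h r(2) by (rule holomorphic_on_subset)
    then obtain g where g: "g holomorphic_on (h ` ball x r)" "\<And>z. z \<in> ball x r \<Longrightarrow> g (h z) = z"
      by (rule holomorphic_has_inverse[OF _ open_ball r(3)]) (rule that)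
    have "open (h ` ball x r)"
      by (rule open_mapping_thm3[OF \<open>h holomorphic_on ball x r\<close> open_ball r(3)])
    then have "g differentiable_on (h ` ball x r)"
      using g(1) holomorphic_on_imp_differentiable_on by blast
    then have diff: "g differentiable_on (S \<inter> h ` ball x r)"
      by (rule differentiable_on_subset) simp
    have "negligible (S \<inter> h ` ball x r)"
      using S by (rule negligible_subset) simp
    then have "negligible (g ` (S \<inter> h ` ball x r))"
      using diff by (rule negligible_differentiable_image_negligible[OF order_refl])
    moreover have "?P \<inter> ball x r \<subseteq> g ` (S \<inter> h ` ball x r)"
      using g(2) by (force simp: image_iff)
    ultimately have "negligible (?P \<inter> ball x r)"
      by (rule negligible_subset)
    with x r(1) show "\<exists>V. openin (top_of_set ?P) V \<and> x \<in> V \<and> negligible V"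
      by (intro exI[of _ "?P \<inter> ball x r"]) auto
  qed
  ultimately have "negligible ({z \<in> U. deriv h z = 0} \<union> ?P)"
    by (rule negligible_Un)
  then show ?thesis by (rule negligible_subset) auto
qed

text \<open>The inequality \<open>ln x \<le> x - 1\<close> at a quotient makes \<open>ln\<close>
  Lipschitz away from 0. This serves to recover limits of real parts from those of moduli of
  exponentials.\<close>

lemma abs_ln_diff_le:
  fixes x y c :: real
  assumes "0 < c" "c \<le> x" "c \<le> y"
  shows "\<bar>ln x - ln y\<bar> \<le> \<bar>x - y\<bar> / c"
proof -
  have *: "ln x - ln y \<le> \<bar>x - y\<bar> / c" if "c \<le> x" "c \<le> y" for x y
  proof -
    have "ln x - ln y = ln (x / y)" using assms(1) that by (simp add: ln_div)
    also have "\<dots> \<le> x / y - 1" using assms(1) that by (intro ln_le_minus_one) auto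
    also have "\<dots> = (x - y) / y" using assms(1) that by (simp add: field_simps)
    also have "\<dots> \<le> \<bar>x - y\<bar> / c" using assms(1) that by (intro frac_le) auto
    finally show ?thesis .
  qed
  show ?thesis using *[OF assms(2,3)] *[OF assms(3,2)] by (auto simp: abs_minus_commute)
qed

lemma open_sublevel:
  fixes v :: "'a::topological_space \<Rightarrow> real"
  assumes "open S" "continuous_on S v"
  shows "open {z \<in> S. \<bar>v z\<bar> < c}"
proof -
  have "{z \<in> S. \<bar>v z\<bar> < c} = S \<inter> (\<lambda>z. \<bar>v z\<bar>) -` {..<c}"
    by auto
  also have "open \<dots>"
    by (intro continuous_open_preimage assms continuous_on_rabs open_lessThan)
  finally show ?thesis .
qed

text \<open>The sublevel sets decrease to the zero set of \<open>v\<close> and have finite measure,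
  so continuity from above applies.\<close>

lemma measure_sublevel_tendsto_0:
  fixes v :: "'a::euclidean_space \<Rightarrow> real"
  assumes S: "open S" "bounded S" and v: "continuous_on S v" and null: "negligible {z \<in> S. v z = 0}"
  shows "(\<lambda>m. measure lebesgue {z \<in> S. \<bar>v z\<bar> < 1 / real (Suc m)}) \<longlonglongrightarrow> 0"
proof -
  define W where "W m = {z \<in> S. \<bar>v z\<bar> < 1 / real (Suc m)}" for m
  have opW: "open (W m)" for m
    unfolding W_def by (rule open_sublevel[OF S(1) v])
  have lm: "W m \<in> lmeasurable" for m
    using S(2) opW by (intro lmeasurable_open) (auto simp: W_def intro: bounded_subset)
  have dec: "decseq W"
  proof (rule decseq_SucI)
    fix m
    have "1 / real (Suc (Suc m)) \<le> 1 / real (Suc m)" by (simp add: frac_le)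
    then show "W (Suc m) \<subseteq> W m" by (auto simp: W_def)
  qed
  have "(\<lambda>m. measure lebesgue (W m)) \<longlonglongrightarrow> measure lebesgue (\<Inter>m. W m)"
    using fmeasurableD[OF lm] fmeasurableD2[OF lm]
    by (intro Lim_measure_decseq dec) (simp_all add: image_subset_iff)
  moreover have "(\<Inter>m. W m) = {z \<in> S. v z = 0}"
  proof
    show "(\<Inter>m. W m) \<subseteq> {z \<in> S. v z = 0}"
    proof
      fix z assume z: "z \<in> (\<Inter>m. W m)"
      have "v z = 0"
      proof (rule ccontr)
        assume "v z \<noteq> 0"
        then obtain m where "inverse (real (Suc m)) < \<bar>v z\<bar>"
          using reals_Archimedean[of "\<bar>v z\<bar>"] by auto
        moreover have "\<bar>v z\<bar> < 1 / real (Suc m)" using z by (auto simp: W_def)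
        ultimately show False by (simp add: inverse_eq_divide)
      qed
      then show "z \<in> {z \<in> S. v z = 0}" using z by (auto simp: W_def)
    qed
  qed (auto simp: W_def)
  ultimately show ?thesis
    using negligible_imp_measure0[OF null] by (simp add: W_def)
qed

text \<open>A compactness argument. Montel's theorem is applied to \<open>exp \<circ> h\<close>, which is bounded although the
  imaginary part of \<open>h\<close> is not controlled; \<open>Re h\<close> is recovered as \<open>ln |exp h|\<close>.\<close>

lemma uniform_sublevel_bound:
  fixes A \<epsilon> r R :: real
  assumes r: "0 < r" "r < R" and \<epsilon>: "0 < \<epsilon>"
  obtains \<eta> where "0 < \<eta>"
    "\<And>h. \<lbrakk>h holomorphic_on ball 0 R; \<And>z. z \<in> ball 0 R \<Longrightarrow> \<bar>Re (h z)\<bar> \<le> A;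
       \<exists>z\<in>ball 0 r. 1 \<le> \<bar>Re (h z)\<bar>\<rbrakk>
       \<Longrightarrow> measure lebesgue {z \<in> ball 0 r. \<bar>Re (h z)\<bar> < \<eta>} < \<epsilon>"
proof (rule ccontr)
  \<comment> \<open>\<open>Q h \<eta>\<close> says that \<open>h\<close> refutes the candidate
    \<open>\<eta>\<close>.\<close>
  define Q where "Q h \<eta> \<longleftrightarrow> h holomorphic_on ball 0 R \<and> (\<forall>z\<in>ball 0 R. \<bar>Re (h z)\<bar> \<le> A) \<and>
      (\<exists>z\<in>ball 0 r. 1 \<le> \<bar>Re (h z)\<bar>) \<and> \<epsilon> \<le> measure lebesgue {z \<in> ball 0 r. \<bar>Re (h z)\<bar> < \<eta>}"
    for h :: "complex \<Rightarrow> complex" and \<eta> :: real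
  note witness = that
  assume "\<not> thesis"
  have "\<exists>h. Q h \<eta>" if "\<eta> > 0" for \<eta>
  proof (rule ccontr)
    assume none: "\<not> (\<exists>h. Q h \<eta>)"
    have thesis
    proof (rule witness[OF that])
      fix h
      assume h: "h holomorphic_on ball 0 R" "\<And>z. z \<in> ball 0 R \<Longrightarrow> \<bar>Re (h z)\<bar> \<le> A"
        "\<exists>z\<in>ball 0 r. 1 \<le> \<bar>Re (h z)\<bar>"
      show "measure lebesgue {z \<in> ball 0 r. \<bar>Re (h z)\<bar> < \<eta>} < \<epsilon>"
      proof (rule ccontr)
        assume "\<not> measure lebesgue {z \<in> ball 0 r. \<bar>Re (h z)\<bar> < \<eta>} < \<epsilon>"
        then have "\<epsilon> \<le> measure lebesgue {z \<in> ball 0 r. \<bar>Re (h z)\<bar> < \<eta>}"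
          by (rule leI)
        then have "Q h \<eta>"
          unfolding Q_def by (intro conjI ballI h)
        with none show False by blast
      qed
    qed
    with \<open>\<not> thesis\<close> show False by contradiction
  qed
  \<comment> \<open>Failure of every candidate yields a sequence of counterexamples for thresholds
    tending to 0.\<close>
  then have "\<forall>n. \<exists>h. Q h (1 / real (Suc n))" by simp
  then obtain h where "\<forall>n. Q (h n) (1 / real (Suc n))"
    unfolding choice_iff by (elim exE)
  note h = this[THEN spec, unfolded Q_def]
  define F where "F n z = exp (h n z)" for n z
  define \<H> where "\<H> = {F. F holomorphic_on ball 0 R \<and> (\<forall>z\<in>ball 0 R. norm (F z) \<le> exp A)}"
  have FH: "range F \<subseteq> \<H>"
  proof (rule image_subsetI)
    fix n
    have "(\<lambda>z. exp (h n z)) holomorphic_on ball 0 R"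
      using h[of n] holomorphic_on_compose[of "h n" "ball 0 R" exp]
      by (simp add: o_def holomorphic_on_exp)
    moreover have "norm (exp (h n z)) \<le> exp A" if "z \<in> ball 0 R" for z
    proof -
      have "\<bar>Re (h n z)\<bar> \<le> A" using h[of n] that by blast
      then show ?thesis by simp
    qed
    ultimately show "F n \<in> \<H>" by (simp add: \<H>_def F_def[abs_def])
  qed
  obtain g k where g: "g holomorphic_on ball 0 R" and k: "strict_mono (k :: nat \<Rightarrow> nat)"
    and ptw: "\<And>z. z \<in> ball 0 R \<Longrightarrow> (\<lambda>n. F (k n) z) \<longlonglongrightarrow> g z"
    and unif: "\<And>K. \<lbrakk>compact K; K \<subseteq> ball 0 R\<rbrakk> \<Longrightarrow> uniform_limit K (F \<circ> k) g sequentially"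
  proof (rule Montel[OF open_ball _ _ FH])
    show "F holomorphic_on ball 0 R" if "F \<in> \<H>" for F using that by (auto simp: \<H>_def)
    show "\<exists>B. \<forall>F\<in>\<H>. \<forall>z\<in>K. norm (F z) \<le> B" if "compact K" "K \<subseteq> ball 0 R" for K
      using that by (intro exI[of _ "exp A"]) (auto simp: \<H>_def)
  qed (rule that)
  \<comment> \<open>As the real parts are also bounded below, the limit \<open>g\<close> has no
    zeros, and the logarithm of its modulus is a continuous limit of the real parts.\<close>
  have Fge: "exp (- A) \<le> norm (F n z)" if "z \<in> ball 0 R" for n z
  proof -
    have "\<bar>Re (h n z)\<bar> \<le> A" using h[of n] that by blast
    then show ?thesis by (simp add: F_def)
  qed
  have gge: "exp (- A) \<le> norm (g z)" if "z \<in> ball 0 R" for z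
    by (rule tendsto_lowerbound[OF tendsto_norm[OF ptw[OF that]] always_eventually[OF allI[OF Fge[OF that]]]])
       (rule sequentially_bot)
  have g0: "g z \<noteq> 0" if "z \<in> ball 0 R" for z
    using less_le_trans[OF exp_gt_zero gge[OF that]] by simp
  define v where "v z = ln (norm (g z))" for z
  have sub: "ball 0 r \<subseteq> ball 0 R" "cball 0 r \<subseteq> ball (0::complex) R" using r by auto
  have conv: "\<forall>\<^sub>F n in sequentially. \<forall>z\<in>ball 0 r. \<bar>Re (h (k n) z) - v z\<bar> < e" if "e > 0" for e
  proof -
    have "\<forall>\<^sub>F n in sequentially. \<forall>z\<in>cball 0 r. dist ((F \<circ> k) n z) (g z) < e * exp (- A)"
      by (rule uniform_limitD[OF unif[OF compact_cball sub(2)]]) (simp add: that)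
    then show ?thesis
    proof eventually_elim
      case (elim n)
      show ?case
      proof
        fix z :: complex assume z: "z \<in> ball 0 r"
        then have zR: "z \<in> ball 0 R" using r by auto
        have eq: "Re (h (k n) z) = ln (norm (F (k n) z))" by (simp add: F_def)
        have "\<bar>Re (h (k n) z) - v z\<bar> \<le> \<bar>norm (F (k n) z) - norm (g z)\<bar> / exp (- A)"
          unfolding v_def eq by (rule abs_ln_diff_le[OF exp_gt_zero Fge[OF zR] gge[OF zR]])
        also have "\<dots> \<le> dist (F (k n) z) (g z) / exp (- A)"
          by (intro divide_right_mono) (auto simp: dist_norm norm_triangle_ineq3)
        also have "\<dots> < e"
          using elim z by (auto simp: pos_divide_less_eq)
        finally show "\<bar>Re (h (k n) z) - v z\<bar> < e" .
      qed
    qed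
  qed
  \<comment> \<open>A constant \<open>g\<close> of modulus 1 would make the real parts eventually
    smaller than 1 in modulus throughout \<open>ball 0 r\<close>, against the choice of
    \<open>h\<close>. A non-constant \<open>g\<close> meets the unit circle only on a null
    set.\<close>
  have null: "negligible {z \<in> ball 0 r. v z = 0}"
  proof (cases "g constant_on ball 0 R")
    case True
    then obtain c where c: "\<And>z. z \<in> ball 0 R \<Longrightarrow> g z = c" by (auto simp: constant_on_def)
    have "\<not> (\<forall>z\<in>ball 0 r. v z = 0)"
    proof
      assume "\<forall>z\<in>ball 0 r. v z = 0"
      then have "\<forall>\<^sub>F n in sequentially. \<forall>z\<in>ball 0 r. \<bar>Re (h (k n) z)\<bar> < 1"
        using conv[of 1] by simp
      then obtain n where n: "\<forall>z\<in>ball 0 r. \<bar>Re (h (k n) z)\<bar> < 1"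
        using eventually_happens by fastforce
      from h[of "k n"] obtain w where w: "w \<in> ball 0 r" "1 \<le> \<bar>Re (h (k n) w)\<bar>" by blast
      with bspec[OF n w(1)] show False by linarith
    qed
    then have "ln (norm c) \<noteq> 0" using c r by (auto simp: v_def)
    then have "{z \<in> ball 0 r. v z = 0} = {}" using c r by (auto simp: v_def)
    then show ?thesis by (simp only: negligible_empty)
  next
    case False
    have "negligible {z \<in> ball 0 R. g z \<in> sphere 0 1}"
      by (intro negligible_holomorphic_vimage g False negligible_sphere) auto
    moreover have "norm (g z) = 1" if "z \<in> ball 0 r" "v z = 0" for z
      using that g0[of z] r by (auto simp: v_def)
    ultimately show ?thesis
      using r by (elim negligible_subset) auto
  qed
  have cont_v: "continuous_on (ball 0 r) v"
    unfolding v_def using sub(1) g0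
    by (intro continuous_on_ln continuous_on_norm holomorphic_on_imp_continuous_on
        holomorphic_on_subset[OF g]) auto
  from measure_sublevel_tendsto_0[OF open_ball bounded_ball cont_v null]
  have lim: "(\<lambda>m. measure lebesgue {z \<in> ball 0 r. \<bar>v z\<bar> < 1 / real (Suc m)}) \<longlonglongrightarrow> 0" .
  then obtain m where m: "measure lebesgue {z \<in> ball 0 r. \<bar>v z\<bar> < 1 / real (Suc m)} < \<epsilon>"
    using eventually_happens'[OF sequentially_bot order_tendstoD(2)[OF lim \<epsilon>]] by (elim exE)
  \<comment> \<open>Half of the threshold for \<open>v\<close>: if the error and the real part are
    both below \<open>b\<close> in modulus, then \<open>v\<close> is below
    \<open>1 / real (Suc m)\<close>. So late counterexamples have sublevel sets of measure less than
    \<open>\<epsilon>\<close>.\<close>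
  define b where "b = 1 / (2 * real (Suc m))"
  have b: "b > 0" "1 / real (Suc m) = 2 * b" by (auto simp: b_def field_simps)
  have "\<forall>\<^sub>F n in sequentially. 1 / real (Suc n) < b"
    using order_tendstoD(2)[OF LIMSEQ_inverse_real_of_nat b(1)] by (simp add: inverse_eq_divide)
  then have "\<forall>\<^sub>F n in sequentially. 1 / real (Suc (k n)) < b"
    by (rule eventually_subseq[OF k])
  with conv[OF b(1)] have "\<forall>\<^sub>F n in sequentially. False"
  proof eventually_elim
    case (elim n)
    have "{z \<in> ball 0 r. \<bar>Re (h (k n) z)\<bar> < 1 / real (Suc (k n))} \<subseteq> {z \<in> ball 0 r. \<bar>v z\<bar> < 1 / real (Suc m)}"
    proof safe
      fix z :: complex assume z: "z \<in> ball 0 r" "\<bar>Re (h (k n) z)\<bar> < 1 / real (Suc (k n))"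
      with elim have "\<bar>Re (h (k n) z) - v z\<bar> < b" by blast
      with z(2) elim(2) b(2) show "\<bar>v z\<bar> < 1 / real (Suc m)" by linarith
    qed
    moreover have "open {z \<in> ball 0 r. \<bar>v z\<bar> < 1 / real (Suc m)}"
      using cont_v by (rule open_sublevel[OF open_ball])
    moreover have "open {z \<in> ball 0 r. \<bar>Re (h (k n) z)\<bar> < 1 / real (Suc (k n))}"
    proof -
      have "h (k n) holomorphic_on ball 0 R" using h[of "k n"] by blast
      then have "h (k n) holomorphic_on ball 0 r"
        using sub(1) by (rule holomorphic_on_subset)
      then show ?thesis
        by (intro open_sublevel open_ball continuous_on_Re holomorphic_on_imp_continuous_on)
    qed
    ultimately have "measure lebesgue {z \<in> ball 0 r. \<bar>Re (h (k n) z)\<bar> < 1 / real (Suc (k n))}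
        \<le> measure lebesgue {z \<in> ball 0 r. \<bar>v z\<bar> < 1 / real (Suc m)}"
      by (intro measure_mono_fmeasurable fmeasurableD lmeasurable_open
          bounded_subset[OF bounded_ball[of "0::complex" r]]) blast+
    with h[of "k n"] m show False by linarith
  qed
  then show False by simp
qed

section \<open>Mean values and sublevel sets of harmonic functions\<close>

lemma harmonic_on_imp_Im_holomorphic:
  assumes f: "harmonic_on f U" and U: "convex U"
  obtains h where "h holomorphic_on U" "\<And>z. z \<in> U \<Longrightarrow> Re (h z) = Im (f z)"
proof -
  obtain h where h: "h holomorphic_on U" "\<And>z. z \<in> U \<Longrightarrow> Re (h z) = Re (- \<i> * f z)"
    by (rule harmonic_on_imp_Re_holomorphic[OF harmonic_on_cmult[OF f, of "- \<i>"] U]) (rule that)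
  show ?thesis
    by (rule that[OF h(1)]) (simp add: h(2))
qed

lemma harmonic_on_subset:
  assumes "harmonic_on f U" "open V" "V \<subseteq> U"
  shows "harmonic_on f V"
proof -
  from assms(1) obtain fx fy fxx fxy fyx fyy where
    c: "continuous_on U fxx" "continuous_on U fxy" "continuous_on U fyx" "continuous_on U fyy"
    and d: "\<forall>z\<in>U.
      (f has_derivative (\<lambda>h. Re h *\<^sub>R fx z + Im h *\<^sub>R fy z)) (at z) \<and>
      (fx has_derivative (\<lambda>h. Re h *\<^sub>R fxx z + Im h *\<^sub>R fxy z)) (at z) \<and>
      (fy has_derivative (\<lambda>h. Re h *\<^sub>R fyx z + Im h *\<^sub>R fyy z)) (at z) \<and>
      fxx z + fyy z = 0"
    unfolding harmonic_on_def by blast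
  have "\<forall>z\<in>V.
      (f has_derivative (\<lambda>h. Re h *\<^sub>R fx z + Im h *\<^sub>R fy z)) (at z) \<and>
      (fx has_derivative (\<lambda>h. Re h *\<^sub>R fxx z + Im h *\<^sub>R fxy z)) (at z) \<and>
      (fy has_derivative (\<lambda>h. Re h *\<^sub>R fyx z + Im h *\<^sub>R fyy z)) (at z) \<and>
      fxx z + fyy z = 0"
    using d assms(3) by blast
  then show ?thesis
    unfolding harmonic_on_def using assms(2) c[THEN continuous_on_subset, OF assms(3)] by blast
qed

lemma set_integrable_continuous_ball:
  fixes g :: "complex \<Rightarrow> 'a::{banach, second_countable_topology}"
  assumes "continuous_on (cball z s) g"
  shows "set_integrable lborel (ball z s) g"
  by (rule set_integrable_subset[OF borel_integrable_compact[OF compact_cball assms, folded set_integrable_def]]) auto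

text \<open>The real and the imaginary part are each the real part of a holomorphic function on
  \<open>ball z R\<close>, so the holomorphic mean value property gives both parts of the
  equation.\<close>

lemma harmonic_area_mean_value:
  assumes f: "harmonic_on f U" and U: "ball z R \<subseteq> U" and s: "0 < s" "s < R"
  shows "of_real (pi * s\<^sup>2) * f z = (LINT w:ball z s|lborel. f w)"
proof -
  have sub: "cball z s \<subseteq> ball z R" using s by auto
  have fR: "harmonic_on f (ball z R)"
    using f open_ball U by (rule harmonic_on_subset)
  obtain h1 where h1: "h1 holomorphic_on ball z R" "\<And>w. w \<in> ball z R \<Longrightarrow> Re (h1 w) = Re (f w)"
    by (rule harmonic_on_imp_Re_holomorphic[OF fR convex_ball]) (rule that)
  obtain h2 where h2: "h2 holomorphic_on ball z R" "\<And>w. w \<in> ball z R \<Longrightarrow> Re (h2 w) = Im (f w)"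
    by (rule harmonic_on_imp_Im_holomorphic[OF fR convex_ball]) (rule that)
  have int: "set_integrable lborel (ball z s) h" if "continuous_on (ball z R) h" for h :: "complex \<Rightarrow> complex"
    by (rule set_integrable_continuous_ball[OF continuous_on_subset[OF that sub]])
  have Re_int: "Re (LINT w:ball z s|lborel. h w) = (LINT w:ball z s|lborel. Re (h w))"
    if "continuous_on (ball z R) h" for h :: "complex \<Rightarrow> complex"
    using int[OF that] unfolding set_lebesgue_integral_def set_integrable_def
    by (subst integral_Re[symmetric]) simp_all
  have Im_int: "Im (LINT w:ball z s|lborel. h w) = (LINT w:ball z s|lborel. Im (h w))"
    if "continuous_on (ball z R) h" for h :: "complex \<Rightarrow> complex"
    using int[OF that] unfolding set_lebesgue_integral_def set_integrable_def
    by (subst integral_Im[symmetric]) simp_all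
  have cf: "continuous_on (ball z R) f" using fR by (rule harmonic_on_imp_continuous_on)
  have zR: "z \<in> ball z R" using s by simp
  have wR: "w \<in> ball z R" if "w \<in> ball z s" for w using that s by simp
  have "Re (LINT w:ball z s|lborel. f w) = (LINT w:ball z s|lborel. Re (h1 w))"
    unfolding Re_int[OF cf] by (intro set_lebesgue_integral_cong) (simp_all add: h1(2)[OF wR])
  also have "\<dots> = Re (of_real (pi * s\<^sup>2) * h1 z)"
    by (simp only: Re_int[OF holomorphic_on_imp_continuous_on[OF h1(1)], symmetric]
        holomorphic_area_mean_value[OF h1(1) s])
  finally have 1: "Re (LINT w:ball z s|lborel. f w) = Re (of_real (pi * s\<^sup>2) * f z)"
    using h1(2)[OF zR] by simp
  have "Im (LINT w:ball z s|lborel. f w) = (LINT w:ball z s|lborel. Re (h2 w))"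
    unfolding Im_int[OF cf] by (intro set_lebesgue_integral_cong) (simp_all add: h2(2)[OF wR])
  also have "\<dots> = Re (of_real (pi * s\<^sup>2) * h2 z)"
    by (simp only: Re_int[OF holomorphic_on_imp_continuous_on[OF h2(1)], symmetric]
        holomorphic_area_mean_value[OF h2(1) s])
  finally have 2: "Im (LINT w:ball z s|lborel. f w) = Im (of_real (pi * s\<^sup>2) * f z)"
    using h2(2)[OF zR] by simp
  from 1 2 show ?thesis by (simp add: complex_eq_iff)
qed

lemma measure_lebesgue_affine_image:
  fixes a :: complex
  assumes "0 < s"
  shows "measure lebesgue ((\<lambda>\<zeta>. a + of_real s * \<zeta>) ` X) = s\<^sup>2 * measure lebesgue X"
  using measure_lebesgue_affine[of s a X] assms by (simp add: scaleR_conv_of_real add.commute)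

text \<open>Where \<open>cmod (f z)\<close> reaches \<open>m / 2\<close>, the real or the imaginary
  part of \<open>f\<close> reaches \<open>m / 4\<close> in modulus. That part is moved to a disk
  about 0 and divided by \<open>m / 4\<close>, which explains the bound \<open>4 * A\<close> and the
  threshold \<open>\<eta> / 4\<close>. Its sublevel set contains that of \<open>f\<close>, since a
  part never exceeds the modulus.\<close>

lemma harmonic_sublevel_bound:
  fixes A \<epsilon> r R :: real
  assumes r: "0 < r" "r < R" and \<epsilon>: "0 < \<epsilon>"
  obtains \<eta> where "0 < \<eta>"
    "\<And>f a s m. \<lbrakk>harmonic_on f (ball a (R * s)); 0 < s; 0 < m;
       \<And>z. z \<in> ball a (R * s) \<Longrightarrow> cmod (f z) \<le> A * m; \<exists>z\<in>ball a (r * s). m / 2 \<le> cmod (f z)\<rbrakk>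
       \<Longrightarrow> measure lebesgue {z \<in> ball a (r * s). cmod (f z) < \<eta> * m} \<le> \<epsilon> * s\<^sup>2"
proof -
  note witness = that
  show ?thesis
  proof (rule uniform_sublevel_bound[OF r \<epsilon>, of "4 * A"])
    fix \<eta>
    assume \<eta>: "0 < \<eta>"
      "\<And>h. \<lbrakk>h holomorphic_on ball 0 R; \<And>z. z \<in> ball 0 R \<Longrightarrow> \<bar>Re (h z)\<bar> \<le> 4 * A;
         \<exists>z\<in>ball 0 r. 1 \<le> \<bar>Re (h z)\<bar>\<rbrakk>
         \<Longrightarrow> measure lebesgue {z \<in> ball 0 r. \<bar>Re (h z)\<bar> < \<eta>} < \<epsilon>"
    show ?thesis
    proof (rule witness[of "\<eta> / 4"])
      show "0 < \<eta> / 4" using \<eta>(1) by simp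
      fix f :: "complex \<Rightarrow> complex" and a :: complex and s m :: real
      assume f: "harmonic_on f (ball a (R * s))" and s: "0 < s" and m: "0 < m"
        and le: "\<And>z. z \<in> ball a (R * s) \<Longrightarrow> cmod (f z) \<le> A * m"
        and ge: "\<exists>z\<in>ball a (r * s). m / 2 \<le> cmod (f z)"
      let ?\<phi> = "\<lambda>\<zeta>. a + of_real s * \<zeta>"
      have \<phi>: "?\<phi> \<zeta> \<in> ball a (t * s) \<longleftrightarrow> \<zeta> \<in> ball 0 t" for \<zeta> t
        using s by (simp add: dist_norm norm_mult mult.commute)
      have \<phi>_inv: "?\<phi> ((z - a) / of_real s) = z" for z
        using s by simp
      have main: "measure lebesgue {z \<in> ball a (r * s). cmod (f z) < \<eta> / 4 * m} \<le> \<epsilon> * s\<^sup>2"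
        if h: "h holomorphic_on ball a (R * s)"
          and hf: "\<And>z. z \<in> ball a (R * s) \<Longrightarrow> \<bar>Re (h z)\<bar> \<le> cmod (f z)"
          and hge: "\<exists>z\<in>ball a (r * s). m / 4 \<le> \<bar>Re (h z)\<bar>" for h
      proof -
        define H where "H \<zeta> = of_real (4 / m) * h (?\<phi> \<zeta>)" for \<zeta>
        have ReH: "\<bar>Re (H \<zeta>)\<bar> = 4 / m * \<bar>Re (h (?\<phi> \<zeta>))\<bar>" for \<zeta>
        proof -
          have "Re (of_real c * w) = c * Re w" for c w by simp
          then show ?thesis using m unfolding H_def by (simp only: abs_mult) simp
        qed
        have holH: "H holomorphic_on ball 0 R"
          unfolding H_def
          by (intro holomorphic_on_mult holomorphic_on_const
              holomorphic_on_compose_gen[OF _ h, unfolded o_def] holomorphic_on_add holomorphic_on_ident)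
             (use \<phi>[of _ R] in blast)
        have leH: "\<bar>Re (H \<zeta>)\<bar> \<le> 4 * A" if "\<zeta> \<in> ball 0 R" for \<zeta>
        proof -
          have "\<bar>Re (h (?\<phi> \<zeta>))\<bar> \<le> A * m"
            using hf le that \<phi>[of \<zeta> R] by (meson order.trans)
          then have "4 / m * \<bar>Re (h (?\<phi> \<zeta>))\<bar> \<le> 4 / m * (A * m)"
            using m by (intro mult_left_mono) auto
          with m show ?thesis by (simp add: ReH)
        qed
        have geH: "\<exists>\<zeta>\<in>ball 0 r. 1 \<le> \<bar>Re (H \<zeta>)\<bar>"
        proof -
          from hge obtain z where z: "z \<in> ball a (r * s)" "m / 4 \<le> \<bar>Re (h z)\<bar>" by blast
          have "(z - a) / of_real s \<in> ball 0 r"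
            using z(1) \<phi>[of "(z - a) / of_real s" r] by (simp only: \<phi>_inv)
          moreover have "1 \<le> \<bar>Re (H ((z - a) / of_real s))\<bar>"
            unfolding ReH \<phi>_inv using z(2) m by (simp add: field_simps)
          ultimately show ?thesis by blast
        qed
        let ?X = "{\<zeta> \<in> ball 0 r. \<bar>Re (H \<zeta>)\<bar> < \<eta>}"
        have opX: "open ?X"
          using holH r by (intro open_sublevel open_ball continuous_on_Re holomorphic_on_imp_continuous_on)
            (rule holomorphic_on_subset, auto)
        have opf: "open {z \<in> ball a (r * s). cmod (f z) < \<eta> / 4 * m}"
        proof -
          have "continuous_on (ball a (r * s)) (\<lambda>z. cmod (f z))"
            using r s by (intro continuous_on_norm continuous_on_subset[OF harmonic_on_imp_continuous_on[OF f]])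
              (simp add: subset_ball)
          from open_sublevel[OF open_ball this] show ?thesis by (simp only: abs_norm_cancel)
        qed
        have sub: "{z \<in> ball a (r * s). cmod (f z) < \<eta> / 4 * m} \<subseteq> ?\<phi> ` ?X"
        proof
          fix z assume z: "z \<in> {z \<in> ball a (r * s). cmod (f z) < \<eta> / 4 * m}"
          have "r * s \<le> R * s" using r s by simp
          with z have "\<bar>Re (h z)\<bar> < \<eta> / 4 * m"
            using hf[of z] by simp
          then have "\<bar>Re (H ((z - a) / of_real s))\<bar> < \<eta>"
            unfolding ReH \<phi>_inv using m by (simp add: field_simps)
          moreover have "(z - a) / of_real s \<in> ball 0 r"
            using z \<phi>[of "(z - a) / of_real s" r] by (simp only: \<phi>_inv mem_Collect_eq)
          ultimately show "z \<in> ?\<phi> ` ?X"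
            by (intro image_eqI[of _ _ "(z - a) / of_real s"]) (simp_all only: \<phi>_inv mem_Collect_eq)
        qed
        have "open (?\<phi> ` ?X)"
          using open_affinity[OF opX, of s a] s by (simp add: scaleR_conv_of_real)
        moreover have "?\<phi> ` ?X \<subseteq> ball a (r * s)"
          using \<phi>[of _ r] by blast
        ultimately have "?\<phi> ` ?X \<in> lmeasurable"
          by (intro lmeasurable_open bounded_subset[OF bounded_ball[of a "r * s"]])
        then have "measure lebesgue {z \<in> ball a (r * s). cmod (f z) < \<eta> / 4 * m} \<le> measure lebesgue (?\<phi> ` ?X)"
          using opf sub by (intro measure_mono_fmeasurable) simp_all
        also have "\<dots> = s\<^sup>2 * measure lebesgue ?X"
          using s by (rule measure_lebesgue_affine_image)
        also have "\<dots> \<le> s\<^sup>2 * \<epsilon>"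
          using \<eta>(2)[OF holH leH geH] by (intro mult_left_mono) auto
        finally show ?thesis by (simp add: mult.commute)
      qed
      from ge obtain z where z: "z \<in> ball a (r * s)" "m / 2 \<le> cmod (f z)" by blast
      have zR: "z \<in> ball a (R * s)"
        using z(1) mult_strict_right_mono[OF r(2) s] by simp
      have "cmod (f z) \<le> \<bar>Re (f z)\<bar> + \<bar>Im (f z)\<bar>" by (rule cmod_le)
      with z(2) consider "m / 4 \<le> \<bar>Re (f z)\<bar>" | "m / 4 \<le> \<bar>Im (f z)\<bar>" by linarith
      then show "measure lebesgue {z \<in> ball a (r * s). cmod (f z) < \<eta> / 4 * m} \<le> \<epsilon> * s\<^sup>2"
      proof cases
        case 1
        obtain h where h: "h holomorphic_on ball a (R * s)" "\<And>w. w \<in> ball a (R * s) \<Longrightarrow> Re (h w) = Re (f w)"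
          by (rule harmonic_on_imp_Re_holomorphic[OF f convex_ball]) (rule that)
        show ?thesis
        proof (rule main[OF h(1)])
          show "\<bar>Re (h w)\<bar> \<le> cmod (f w)" if "w \<in> ball a (R * s)" for w
            using h(2)[OF that] abs_Re_le_cmod[of "f w"] by simp
          have "m / 4 \<le> \<bar>Re (h z)\<bar>" using 1 h(2)[OF zR] by simp
          with z(1) show "\<exists>z\<in>ball a (r * s). m / 4 \<le> \<bar>Re (h z)\<bar>" by blast
        qed
      next
        case 2
        obtain h where h: "h holomorphic_on ball a (R * s)" "\<And>w. w \<in> ball a (R * s) \<Longrightarrow> Re (h w) = Im (f w)"
          by (rule harmonic_on_imp_Im_holomorphic[OF f convex_ball]) (rule that)
        show ?thesis
        proof (rule main[OF h(1)])
          show "\<bar>Re (h w)\<bar> \<le> cmod (f w)" if "w \<in> ball a (R * s)" for w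
            using h(2)[OF that] abs_Im_le_cmod[of "f w"] by simp
          have "m / 4 \<le> \<bar>Re (h z)\<bar>" using 2 h(2)[OF zR] by simp
          with z(1) show "\<exists>z\<in>ball a (r * s). m / 4 \<le> \<bar>Re (h z)\<bar>" by blast
        qed
      qed
    qed
  qed
qed

section \<open>The weighted area measure\<close>

lemma space_disk_area [simp]: "space disk_area = unit_disk"
  by (simp add: disk_area_def space_restrict_space)

lemma sets_disk_area: "sets disk_area = sets (lebesgue_on unit_disk)"
  by (simp add: disk_area_def)

lemma in_sets_disk_area_iff: "E \<in> sets disk_area \<longleftrightarrow> E \<in> sets lebesgue \<and> E \<subseteq> unit_disk"
  by (auto simp: sets_disk_area sets_restrict_space_iff)

lemma open_in_sets_disk_area: "open E \<Longrightarrow> E \<subseteq> unit_disk \<Longrightarrow> E \<in> sets disk_area"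
  by (simp add: in_sets_disk_area_iff)

lemma emeasure_unit_disk: "emeasure (lebesgue_on unit_disk) unit_disk = ennreal pi"
  using emeasure_lborel_ball_complex[of 1 0] by (simp add: emeasure_restrict_space)

lemma emeasure_disk_area:
  assumes "E \<in> sets disk_area"
  shows "emeasure disk_area E = emeasure lebesgue E / ennreal pi"
proof -
  have E: "E \<in> sets lebesgue" "E \<subseteq> unit_disk" using assms by (auto simp: in_sets_disk_area_iff)
  have "emeasure disk_area E = emeasure (lebesgue_on unit_disk) (unit_disk \<inter> E) / ennreal pi"
    using E unfolding disk_area_def
    by (subst emeasure_uniform_measure) (auto simp: emeasure_unit_disk sets_restrict_space_iff)
  also have "unit_disk \<inter> E = E" using E by blast
  finally show ?thesis using E by (simp add: emeasure_restrict_space)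
qed

lemma measure_disk_area:
  assumes "E \<in> sets disk_area"
  shows "measure disk_area E = measure lebesgue E / pi"
proof -
  have "E \<in> sets lebesgue" "E \<subseteq> unit_disk" using assms by (auto simp: in_sets_disk_area_iff)
  then have "E \<in> lmeasurable"
    using bounded_set_imp_lmeasurable bounded_subset bounded_ball by blast
  then have "emeasure lebesgue E = ennreal (measure lebesgue E)"
    by (rule emeasure_eq_ennreal_measure[OF fmeasurableD2])
  then have "emeasure disk_area E = ennreal (measure lebesgue E / pi)"
    unfolding emeasure_disk_area[OF assms] by (simp only: divide_ennreal[OF measure_nonneg pi_gt_zero])
  then show ?thesis
    by (intro measure_eq_emeasure_eq_ennreal) simp_all
qed

lemma finite_measure_disk_area: "finite_measure disk_area"
  by (rule finite_measureI)
     (simp add: emeasure_disk_area open_in_sets_disk_area ennreal_divide_eq_top_iff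
       emeasure_lborel_ball_complex[of 1 0, simplified])

lemma measure_disk_area_ball:
  assumes "ball a t \<subseteq> unit_disk" "0 \<le> t"
  shows "measure disk_area (ball a t) = t\<^sup>2"
  using assms by (simp add: measure_disk_area open_in_sets_disk_area measure_lborel_ball_complex)

lemma borel_measurable_disk_area:
  fixes g :: "complex \<Rightarrow> 'a::euclidean_space"
  assumes "continuous_on unit_disk g"
  shows "g \<in> borel_measurable disk_area"
  using continuous_imp_measurable_on_sets_lebesgue[OF assms]
  by (simp add: measurable_cong_sets[OF sets_disk_area refl])

text \<open>Connects mean values, which are integrals over \<open>lborel\<close>, with
  \<open>disk_area\<close>. Measurability is asked only of the product with the indicator, so the
  values of \<open>g\<close> off \<open>B\<close> do not matter; for Borel functions, completing the
  measure leaves the integral unchanged.\<close>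

lemma nn_integral_disk_area_lborel:
  fixes g :: "complex \<Rightarrow> ennreal"
  assumes "B \<subseteq> unit_disk" and g: "(\<lambda>z. g z * indicator B z) \<in> borel_measurable borel"
  shows "(\<integral>\<^sup>+z\<in>B. g z \<partial>disk_area) = (\<integral>\<^sup>+z\<in>B. g z \<partial>lborel) / ennreal pi"
proof -
  have "(\<lambda>z. g z * indicator B z) \<in> borel_measurable lebesgue"
    using g by (simp add: measurable_completion)
  then have "(\<lambda>z. g z * indicator B z) \<in> borel_measurable (lebesgue_on unit_disk)"
    by (rule measurable_restrict_space1)
  then have "(\<integral>\<^sup>+z\<in>B. g z \<partial>disk_area) =
      (\<integral>\<^sup>+z. g z * indicator B z * indicator unit_disk z \<partial>lebesgue_on unit_disk) / ennreal pi"
    unfolding disk_area_def by (subst nn_integral_uniform_measure)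
      (simp_all add: emeasure_unit_disk sets_restrict_space_iff)
  also have "(\<integral>\<^sup>+z. g z * indicator B z * indicator unit_disk z \<partial>lebesgue_on unit_disk) =
      (\<integral>\<^sup>+z. g z * indicator B z * indicator unit_disk z * indicator unit_disk z \<partial>lebesgue)"
    by (subst nn_integral_restrict_space) simp_all
  also have "\<dots> = (\<integral>\<^sup>+z\<in>B. g z \<partial>lebesgue)"
    using assms(1) by (intro nn_integral_cong) (auto simp: indicator_def)
  finally show ?thesis by (simp add: nn_integral_completion)
qed

section \<open>Consequences of the Cauchy--Schwarz inequality and the A2 condition\<close>

text \<open>Where \<open>\<omega>\<close> is positive, \<open>\<phi> z\<close> is the product of
  \<open>\<phi> z * sqrt (\<omega> z)\<close> and
  \<open>sqrt (inverse (\<omega> z))\<close>.\<close>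

lemma weighted_Cauchy_Schwarz:
  fixes \<phi> \<omega> :: "'a \<Rightarrow> real"
  assumes [measurable]: "\<phi> \<in> borel_measurable M" "\<omega> \<in> borel_measurable M" "E \<in> sets M"
    and nonneg: "\<And>z. 0 \<le> \<phi> z" and pos: "AE z in M. 0 < \<omega> z"
  shows "(\<integral>\<^sup>+z\<in>E. ennreal (\<phi> z) \<partial>M)\<^sup>2 \<le>
    (\<integral>\<^sup>+z\<in>E. ennreal ((\<phi> z)\<^sup>2 * \<omega> z) \<partial>M) * (\<integral>\<^sup>+z\<in>E. ennreal (inverse (\<omega> z)) \<partial>M)"
proof -
  let ?f = "\<lambda>z. ennreal (\<phi> z * sqrt (\<omega> z)) * indicator E z"
  let ?g = "\<lambda>z. ennreal (sqrt (inverse (\<omega> z))) * indicator E z"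
  have "(\<integral>\<^sup>+z. ?f z * ?g z \<partial>M)\<^sup>2 \<le> (\<integral>\<^sup>+z. (?f z)\<^sup>2 \<partial>M) * (\<integral>\<^sup>+z. (?g z)\<^sup>2 \<partial>M)"
    by (rule Cauchy_Schwarz_nn_integral) measurable
  also have "(\<integral>\<^sup>+z. ?f z * ?g z \<partial>M) = (\<integral>\<^sup>+z\<in>E. ennreal (\<phi> z) \<partial>M)"
  proof (rule nn_integral_cong_AE, use pos in eventually_elim)
    fix z assume "0 < \<omega> z"
    then have "ennreal (\<phi> z * sqrt (\<omega> z)) * ennreal (sqrt (inverse (\<omega> z))) = ennreal (\<phi> z)"
      using nonneg[of z] by (simp add: real_sqrt_inverse flip: ennreal_mult)
    then show "?f z * ?g z = ennreal (\<phi> z) * indicator E z"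
      by (simp add: indicator_def)
  qed
  also have "(\<integral>\<^sup>+z. (?f z)\<^sup>2 \<partial>M) = (\<integral>\<^sup>+z\<in>E. ennreal ((\<phi> z)\<^sup>2 * \<omega> z) \<partial>M)"
  proof (rule nn_integral_cong_AE, use pos in eventually_elim)
    fix z assume "0 < \<omega> z"
    then have "(ennreal (\<phi> z * sqrt (\<omega> z)))\<^sup>2 = ennreal ((\<phi> z)\<^sup>2 * \<omega> z)"
      using nonneg[of z] by (simp add: ennreal_power power_mult_distrib)
    then show "(?f z)\<^sup>2 = ennreal ((\<phi> z)\<^sup>2 * \<omega> z) * indicator E z"
      by (simp add: indicator_def)
  qed
  also have "(\<integral>\<^sup>+z. (?g z)\<^sup>2 \<partial>M) = (\<integral>\<^sup>+z\<in>E. ennreal (inverse (\<omega> z)) \<partial>M)"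
  proof (rule nn_integral_cong_AE, use pos in eventually_elim)
    fix z assume "0 < \<omega> z"
    then have "(ennreal (sqrt (inverse (\<omega> z))))\<^sup>2 = ennreal (inverse (\<omega> z))"
      by (simp add: ennreal_power)
    then show "(?g z)\<^sup>2 = ennreal (inverse (\<omega> z)) * indicator E z"
      by (simp add: indicator_def)
  qed
  finally show ?thesis .
qed

text \<open>For a ball inside the disk the truncation changes nothing and the normalized area is
  \<open>t\<^sup>2\<close>; the fourth power is the squared area in the characteristic.\<close>

lemma A2_ball:
  assumes A2: "A2_characteristic \<omega> \<le> ennreal K" and K: "0 \<le> K"
    and a: "a \<in> unit_disk" and t: "0 < t" "t < 1" and sub: "ball a t \<subseteq> unit_disk"
  shows "weighted_area \<omega> (ball a t) * weighted_area (\<lambda>z. inverse (\<omega> z)) (ball a t) \<le> ennreal (K * t ^ 4)"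
proof -
  have eq: "trace_ball a t = ball a t"
    using sub by (auto simp: trace_ball_def dist_norm norm_minus_commute)
  interpret finite_measure disk_area by (rule finite_measure_disk_area)
  have m: "(emeasure disk_area (trace_ball a t))\<^sup>2 = ennreal (t ^ 4)"
    using t by (simp add: eq emeasure_eq_measure measure_disk_area_ball[OF sub] ennreal_power flip: power_mult)
  let ?x = "weighted_area \<omega> (ball a t) * weighted_area (\<lambda>z. inverse (\<omega> z)) (ball a t)"
  have "?x / ennreal (t ^ 4) \<le> A2_characteristic \<omega>"
    unfolding A2_characteristic_def
    using a t by (intro SUP_upper2[of a] SUP_upper2[of t]) (simp_all only: m, simp_all add: eq)
  also note A2
  finally have "?x / ennreal (t ^ 4) * ennreal (t ^ 4) \<le> ennreal K * ennreal (t ^ 4)"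
    by (rule mult_right_mono) simp
  moreover have "?x / ennreal (t ^ 4) * ennreal (t ^ 4) = ?x"
    using t by (simp add: ennreal_divide_times)
  ultimately show ?thesis
    using K t by (simp add: ennreal_mult)
qed

text \<open>The Cauchy--Schwarz inequality for the function 1 on \<open>E\<close>, after which the
  integral of the inverse weight is enlarged to the ball. Thus a proportion of area yields a
  proportion of weighted area; the product form avoids division in \<open>ennreal\<close>.\<close>

lemma weighted_area_ge:
  assumes \<omega>: "\<omega> \<in> borel_measurable disk_area" "AE z in disk_area. 0 < \<omega> z"
    and A2: "A2_characteristic \<omega> \<le> ennreal K" and K: "0 \<le> K"
    and a: "a \<in> unit_disk" and t: "0 < t" "t < 1" and sub: "ball a t \<subseteq> unit_disk"
    and E: "E \<in> sets disk_area" "E \<subseteq> ball a t"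
  shows "ennreal ((measure disk_area E)\<^sup>2) * weighted_area \<omega> (ball a t) \<le> ennreal (K * t ^ 4) * weighted_area \<omega> E"
proof -
  interpret finite_measure disk_area by (rule finite_measure_disk_area)
  have "ennreal ((measure disk_area E)\<^sup>2) = (\<integral>\<^sup>+z\<in>E. ennreal 1 \<partial>disk_area)\<^sup>2"
    using E by (simp add: emeasure_eq_measure ennreal_power)
  also have "\<dots> \<le> weighted_area \<omega> E * weighted_area (\<lambda>z. inverse (\<omega> z)) E"
    using weighted_Cauchy_Schwarz[of "\<lambda>_. 1" disk_area \<omega> E] \<omega> E by (simp add: weighted_area_def)
  also have "\<dots> \<le> weighted_area \<omega> E * weighted_area (\<lambda>z. inverse (\<omega> z)) (ball a t)"
    unfolding weighted_area_def by (intro mult_left_mono nn_set_integral_set_mono E) simp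
  finally have "ennreal ((measure disk_area E)\<^sup>2) * weighted_area \<omega> (ball a t) \<le>
      weighted_area \<omega> E * weighted_area (\<lambda>z. inverse (\<omega> z)) (ball a t) * weighted_area \<omega> (ball a t)"
    by (rule mult_right_mono) simp
  also have "\<dots> = (weighted_area \<omega> (ball a t) * weighted_area (\<lambda>z. inverse (\<omega> z)) (ball a t)) * weighted_area \<omega> E"
    by (simp only: mult_ac)
  also have "\<dots> \<le> ennreal (K * t ^ 4) * weighted_area \<omega> E"
    by (intro mult_right_mono A2_ball[OF A2 K a t sub]) simp
  finally show ?thesis .
qed

text \<open>The triangle inequality in the mean value property; the normalization of
  \<open>disk_area\<close> cancels the factor \<open>pi\<close>. The radius \<open>q'\<close>
  provides the room around the disk of radius \<open>q\<close>.\<close>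

lemma harmonic_le_mean:
  assumes f: "harmonic_on f unit_disk" and z: "ball z q' \<subseteq> unit_disk" and q: "0 < q" "q < q'"
  shows "ennreal (q\<^sup>2 * cmod (f z)) \<le> (\<integral>\<^sup>+w\<in>ball z q. ennreal (cmod (f w)) \<partial>disk_area)"
proof -
  have sub: "ball z q \<subseteq> unit_disk" "cball z q \<subseteq> unit_disk"
    using z q by (auto simp: subset_iff)
  have cf: "continuous_on (cball z q) f"
    using harmonic_on_imp_continuous_on[OF f] sub(2) by (rule continuous_on_subset)
  have int: "integrable lborel (\<lambda>w. indicat_real (ball z q) w *\<^sub>R f w)"
    using set_integrable_continuous_ball[OF cf] by (simp add: set_integrable_def)
  have "pi * q\<^sup>2 * cmod (f z) = cmod (LINT w:ball z q|lborel. f w)"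
    by (simp add: harmonic_area_mean_value[OF f z q, symmetric] norm_mult del: of_real_mult of_real_power)
  then have "ennreal (pi * q\<^sup>2 * cmod (f z)) \<le> (\<integral>\<^sup>+w. ennreal (norm (indicat_real (ball z q) w *\<^sub>R f w)) \<partial>lborel)"
    unfolding set_lebesgue_integral_def by (simp only: integral_norm_bound_ennreal[OF int])
  also have "\<dots> = (\<integral>\<^sup>+w\<in>ball z q. ennreal (cmod (f w)) \<partial>lborel)"
    by (intro nn_integral_cong) (auto simp: indicator_def)
  finally have "ennreal (pi * q\<^sup>2 * cmod (f z)) / ennreal pi \<le> (\<integral>\<^sup>+w\<in>ball z q. ennreal (cmod (f w)) \<partial>lborel) / ennreal pi"
    by (rule divide_right_mono_ennreal)
  also have "\<dots> = (\<integral>\<^sup>+w\<in>ball z q. ennreal (cmod (f w)) \<partial>disk_area)"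
  proof (rule nn_integral_disk_area_lborel[OF sub(1), symmetric])
    have "(\<lambda>w. ennreal (norm (indicat_real (ball z q) w *\<^sub>R f w))) \<in> borel_measurable borel"
      using borel_measurable_integrable[OF int] by measurable
    moreover have "(\<lambda>w. ennreal (norm (indicat_real (ball z q) w *\<^sub>R f w))) =
        (\<lambda>w. ennreal (cmod (f w)) * indicator (ball z q) w)"
      by (auto simp: indicator_def)
    ultimately show "(\<lambda>w. ennreal (cmod (f w)) * indicator (ball z q) w) \<in> borel_measurable borel"
      by (simp only:)
  qed
  also have "ennreal (pi * q\<^sup>2 * cmod (f z)) / ennreal pi = ennreal (q\<^sup>2 * cmod (f z))"
    by (subst divide_ennreal) auto
  finally show ?thesis .
qed

text \<open>The mean over \<open>ball z q\<close> is enlarged to \<open>ball a t\<close>, where the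
  Cauchy--Schwarz inequality separates \<open>f\<close> from the inverse weight and
  \<open>A2_ball\<close> removes the latter.\<close>

lemma harmonic_weighted_pointwise_bound:
  assumes \<omega>: "\<omega> \<in> borel_measurable disk_area" "AE z in disk_area. 0 < \<omega> z"
    and A2: "A2_characteristic \<omega> \<le> ennreal K" and K: "0 \<le> K"
    and a: "a \<in> unit_disk" and t: "0 < t" "t < 1" and sub: "ball a t \<subseteq> unit_disk"
    and f: "harmonic_on f unit_disk" and z: "ball z q' \<subseteq> unit_disk" and q: "0 < q" "q < q'"
    and zq: "ball z q \<subseteq> ball a t"
  shows "ennreal (q ^ 4 * (cmod (f z))\<^sup>2) * weighted_area \<omega> (ball a t) \<le>
    ennreal (K * t ^ 4) * (\<integral>\<^sup>+w\<in>ball a t. ennreal ((cmod (f w))\<^sup>2 * \<omega> w) \<partial>disk_area)"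
proof -
  let ?J = "\<integral>\<^sup>+w\<in>ball a t. ennreal ((cmod (f w))\<^sup>2 * \<omega> w) \<partial>disk_area"
  have [measurable]: "f \<in> borel_measurable disk_area"
    by (intro borel_measurable_disk_area harmonic_on_imp_continuous_on f)
  have "ennreal (q ^ 4 * (cmod (f z))\<^sup>2) = (ennreal (q\<^sup>2 * cmod (f z)))\<^sup>2"
    by (simp add: ennreal_power power_mult_distrib flip: power_mult)
  also have "\<dots> \<le> (\<integral>\<^sup>+w\<in>ball z q. ennreal (cmod (f w)) \<partial>disk_area)\<^sup>2"
    by (intro power_mono harmonic_le_mean[OF f z q]) simp
  also have "\<dots> \<le> (\<integral>\<^sup>+w\<in>ball a t. ennreal (cmod (f w)) \<partial>disk_area)\<^sup>2"
    by (intro power_mono nn_set_integral_set_mono zq) simp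
  also have "\<dots> \<le> ?J * weighted_area (\<lambda>z. inverse (\<omega> z)) (ball a t)"
    unfolding weighted_area_def using sub
    by (intro weighted_Cauchy_Schwarz \<omega> open_in_sets_disk_area) simp_all
  finally have "ennreal (q ^ 4 * (cmod (f z))\<^sup>2) * weighted_area \<omega> (ball a t) \<le>
      ?J * weighted_area (\<lambda>z. inverse (\<omega> z)) (ball a t) * weighted_area \<omega> (ball a t)"
    by (rule mult_right_mono) simp
  also have "\<dots> = (weighted_area \<omega> (ball a t) * weighted_area (\<lambda>z. inverse (\<omega> z)) (ball a t)) * ?J"
    by (simp only: mult_ac)
  also have "\<dots> \<le> ennreal (K * t ^ 4) * ?J"
    by (intro mult_right_mono A2_ball[OF A2 K a t sub]) simp
  finally show ?thesis .
qed

section \<open>The estimate on a single Whitney disk\<close>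

text \<open>The radius \<open>R\<close> leaves room on both sides: points of the
  \<open>R\<close>-disk are centres of disks of fixed proportion inside the
  \<open>\<rho>\<close>-disk, as the pointwise bound needs, and the sublevel estimate on the
  \<open>r\<close>-disk needs a bound on a larger one. All constants are fixed before
  \<open>f\<close>, \<open>a\<close> and \<open>E\<close>.\<close>

lemma local_estimate:
  fixes r R \<rho> K \<delta> \<epsilon> :: real
  assumes \<omega>: "integrable disk_area \<omega>" "AE z in disk_area. 0 < \<omega> z"
    and A2: "A2_characteristic \<omega> \<le> ennreal K" and K: "0 < K"
    and r: "0 < r" "r < R" "R < \<rho>" "\<rho> < 1" and \<delta>: "0 < \<delta>" and \<epsilon>: "0 < \<epsilon>"
  obtains C where "0 < C"
    "\<And>f a E. \<lbrakk>f \<in> L2h \<omega>; a \<in> unit_disk; E \<in> sets disk_area; E \<subseteq> ball a (r * (1 - cmod a));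
       \<delta> * measure disk_area (ball a (r * (1 - cmod a))) \<le> measure disk_area E\<rbrakk>
     \<Longrightarrow> (\<integral>\<^sup>+z\<in>ball a (r * (1 - cmod a)). ennreal ((cmod (f z))\<^sup>2 * \<omega> z) \<partial>disk_area)
       \<le> ennreal \<epsilon> * (\<integral>\<^sup>+z\<in>ball a (\<rho> * (1 - cmod a)). ennreal ((cmod (f z))\<^sup>2 * \<omega> z) \<partial>disk_area)
         + ennreal C * (\<integral>\<^sup>+z\<in>E. ennreal ((cmod (f z))\<^sup>2 * \<omega> z) \<partial>disk_area)"
proof -
  note witness = that
  \<comment> \<open>\<open>K\<close> and the fourth power of the ratio of radii come from the
    pointwise bound, \<open>1 / \<epsilon>\<close> from the case in which the
    \<open>\<epsilon>\<close>-term does not dominate.\<close>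
  define B where "B = K * (\<rho> / (\<rho> - R)) ^ 4 / \<epsilon>"
  have B: "0 < B" using K r \<epsilon> by (simp add: B_def)
  \<comment> \<open>The exceptional set may have half of \<open>\<delta>\<close> times the Lebesgue
    area of a disk of radius \<open>r\<close>, before scaling by \<open>s\<close>; so at least half
    of the area guaranteed for \<open>E\<close> remains.\<close>
  have \<epsilon>': "0 < \<delta> / 2 * (pi * r\<^sup>2)" using \<delta> r by simp
  show ?thesis
  proof (rule harmonic_sublevel_bound[OF r(1,2) \<epsilon>', of "sqrt B"])
    fix \<eta>
    assume \<eta>: "0 < \<eta>"
      and sublevel: "\<And>f a s m. \<lbrakk>harmonic_on f (ball a (R * s)); 0 < s; 0 < m;
       \<And>z. z \<in> ball a (R * s) \<Longrightarrow> cmod (f z) \<le> sqrt B * m; \<exists>z\<in>ball a (r * s). m / 2 \<le> cmod (f z)\<rbrakk>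
       \<Longrightarrow> measure lebesgue {z \<in> ball a (r * s). cmod (f z) < \<eta> * m} \<le> \<delta> / 2 * (pi * r\<^sup>2) * s\<^sup>2"
    \<comment> \<open>\<open>4 / \<delta>\<^sup>2\<close> arises from squaring the remaining
      proportion \<open>\<delta> / 2\<close>, and \<open>1 / \<eta>\<^sup>2\<close> from the lower
      bound \<open>\<eta> * m\<close> for \<open>cmod (f z)\<close>.\<close>
    define C where "C = 4 * K / (\<delta>\<^sup>2 * \<eta>\<^sup>2)"
    have C: "0 < C" using K \<delta> \<eta> by (simp add: C_def)
    show thesis
    proof (rule witness[OF C])
      fix f a E
      assume f: "f \<in> L2h \<omega>" and a: "a \<in> unit_disk" and E: "E \<in> sets disk_area"
        and ES: "E \<subseteq> ball a (r * (1 - cmod a))"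
        and \<delta>E: "\<delta> * measure disk_area (ball a (r * (1 - cmod a))) \<le> measure disk_area E"
      interpret finite_measure disk_area by (rule finite_measure_disk_area)
      define s where "s = 1 - cmod a"
      have s: "0 < s" "s \<le> 1" using a by (auto simp: s_def)
      define J where "J X = (\<integral>\<^sup>+z\<in>X. ennreal ((cmod (f z))\<^sup>2 * \<omega> z) \<partial>disk_area)" for X
      have J_mono: "J X \<le> J Y" if "X \<subseteq> Y" for X Y
        unfolding J_def by (rule nn_set_integral_set_mono[OF that])
      have w_mono: "weighted_area \<omega> X \<le> weighted_area \<omega> Y" if "X \<subseteq> Y" for X Y
        unfolding weighted_area_def by (rule nn_set_integral_set_mono[OF that])
      have [measurable]: "\<omega> \<in> borel_measurable disk_area"
        using \<omega>(1) by (rule borel_measurable_integrable)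
      have hf: "harmonic_on f unit_disk" using f by (simp add: L2h_def)
      have cf: "continuous_on unit_disk f" using hf by (rule harmonic_on_imp_continuous_on)
      have [measurable]: "f \<in> borel_measurable disk_area"
        using cf by (rule borel_measurable_disk_area)
      \<comment> \<open>Finiteness of the weighted integrals lets later inequalities pass from
        \<open>ennreal\<close> to \<open>real\<close>, where factors can be cancelled.\<close>
      have w_fin: "weighted_area \<omega> X < \<infinity>" for X
      proof -
        have "weighted_area \<omega> X \<le> (\<integral>\<^sup>+z. ennreal (norm (\<omega> z)) \<partial>disk_area)"
          unfolding weighted_area_def by (intro nn_integral_mono) (auto simp: indicator_def intro: ennreal_leI)
        also have "\<dots> < \<infinity>" using \<omega>(1) by (simp add: integrable_iff_bounded)
        finally show ?thesis .
      qed
      have J_fin: "J X < \<infinity>" for X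
      proof -
        have "J X \<le> (\<integral>\<^sup>+z. ennreal ((cmod (f z))\<^sup>2 * \<omega> z) \<partial>disk_area)"
          unfolding J_def by (intro nn_integral_mono) (auto simp: indicator_def)
        also have "\<dots> < \<infinity>" using f by (simp add: L2h_def)
        finally show ?thesis .
      qed
      have in_disk: "ball z q \<subseteq> unit_disk" if "dist a z + q \<le> s" for z q
      proof
        fix w assume "w \<in> ball z q"
        then have "dist z w < q" by simp
        then have "dist 0 w < cmod a + dist a z + q"
          using dist_triangle[of 0 w a] dist_triangle[of a w z] by simp
        with that show "w \<in> unit_disk" by (simp add: s_def)
      qed
      define S where "S = ball a (r * s)"
      define T where "T = ball a (\<rho> * s)"
      have rs: "0 < r * s" "r * s < R * s" "R * s < \<rho> * s" "\<rho> * s < s" "\<rho> * s < 1" "r * s < 1" "0 < \<rho> * s"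
      proof -
        show *: "0 < r * s" "r * s < R * s" "R * s < \<rho> * s" "\<rho> * s < s" using r s by simp_all
        with s show "\<rho> * s < 1" "r * s < 1" "0 < \<rho> * s" by linarith+
      qed
      have S_disk: "S \<subseteq> unit_disk"
        unfolding S_def by (rule in_disk, unfold dist_self, use rs in linarith)
      have T_disk: "T \<subseteq> unit_disk"
        unfolding T_def by (rule in_disk, unfold dist_self, use rs in linarith)
      have ST: "S \<subseteq> T" using rs unfolding S_def T_def by (intro subset_ball) linarith
      have ES': "E \<subseteq> S" using ES by (simp add: S_def s_def)
      define m where "m = (SUP z\<in>S. cmod (f z))"
      have bdd: "bdd_above ((\<lambda>z. cmod (f z)) ` S)"
      proof -
        have "cball a (r * s) \<subseteq> ball a s"
          by (intro subsetI, unfold mem_cball mem_ball, use rs in linarith)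
        also have "\<dots> \<subseteq> unit_disk" by (rule in_disk) simp
        finally have "cball a (r * s) \<subseteq> unit_disk" .
        then have "compact ((\<lambda>z. cmod (f z)) ` cball a (r * s))"
          by (intro compact_continuous_image continuous_on_norm continuous_on_subset[OF cf]) simp_all
        then have "bdd_above ((\<lambda>z. cmod (f z)) ` cball a (r * s))"
          by (intro bounded_imp_bdd_above compact_imp_bounded)
        then show ?thesis
          by (rule bdd_above_mono) (auto simp: S_def)
      qed
      have le_m: "cmod (f z) \<le> m" if "z \<in> S" for z
        unfolding m_def by (rule cSUP_upper[OF that bdd])
      have aS: "a \<in> S" using rs by (simp add: S_def)
      have m0: "0 \<le> m" using le_m[OF aS] by (rule order.trans[OF norm_ge_zero])
      have JS: "J S \<le> ennreal (m\<^sup>2) * weighted_area \<omega> S"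
      proof -
        have "J S \<le> (\<integral>\<^sup>+z. ennreal (m\<^sup>2) * (ennreal (\<omega> z) * indicator S z) \<partial>disk_area)"
          unfolding J_def
        proof (rule nn_integral_mono_AE, use \<omega>(2) in eventually_elim)
          fix z assume z: "0 < \<omega> z"
          show "ennreal ((cmod (f z))\<^sup>2 * \<omega> z) * indicator S z \<le> ennreal (m\<^sup>2) * (ennreal (\<omega> z) * indicator S z)"
          proof (cases "z \<in> S")
            case True
            have "(cmod (f z))\<^sup>2 * \<omega> z \<le> m\<^sup>2 * \<omega> z"
              using le_m[OF True] z by (intro mult_right_mono power_mono) simp_all
            with z True show ?thesis by (simp add: ennreal_leI flip: ennreal_mult)
          qed simp
        qed
        also have "\<dots> = ennreal (m\<^sup>2) * weighted_area \<omega> S"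
          unfolding weighted_area_def using S_disk
          by (intro nn_integral_cmult borel_measurable_times_ennreal borel_measurable_indicator)
             (simp_all add: S_def open_in_sets_disk_area)
        finally show ?thesis .
      qed
      have "J S \<le> ennreal \<epsilon> * J T + ennreal C * J E"
        \<comment> \<open>If the first term does not dominate, then \<open>f\<close> is comparable to its supremum over \<open>S\<close> on most of \<open>S\<close>,
          hence on most of \<open>E\<close>.\<close>
      proof (cases "J S \<le> ennreal \<epsilon> * J T")
        case True
        then show ?thesis by (rule order.trans) simp
      next
        case False
        then have big: "ennreal \<epsilon> * J T < J S" by simp
        obtain wS where wS: "0 \<le> wS" "weighted_area \<omega> S = ennreal wS"
          using w_fin[of S] by (cases "weighted_area \<omega> S") auto
        obtain wT where wT: "0 \<le> wT" "weighted_area \<omega> T = ennreal wT"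
          using w_fin[of T] by (cases "weighted_area \<omega> T") auto
        obtain jT where jT: "0 \<le> jT" "J T = ennreal jT"
          using J_fin[of T] by (cases "J T") auto
        have "wS \<le> wT" using w_mono[OF ST] wS wT by simp
        have "ennreal (\<epsilon> * jT) < ennreal (m\<^sup>2 * wS)"
          using less_le_trans[OF big JS] \<epsilon> jT wS by (simp add: ennreal_mult)
        then have *: "\<epsilon> * jT < m\<^sup>2 * wS" using \<epsilon> jT(1) by (simp add: ennreal_less_iff)
        have "0 \<le> \<epsilon> * jT" using \<epsilon> jT(1) by simp
        with * have "0 < m\<^sup>2 * wS" by linarith
        then have "m \<noteq> 0" "wS \<noteq> 0" by auto
        with m0 wS(1) \<open>wS \<le> wT\<close> have m: "0 < m" and "0 < wS" "0 < wT" by auto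
        \<comment> \<open>The strict inequality of this case, \<open>JS\<close> and
          \<open>wS \<le> wT\<close> together control the integral over \<open>T\<close> by the
          supremum over \<open>S\<close> alone.\<close>
        have jT_le: "jT \<le> m\<^sup>2 * wT / \<epsilon>"
          using * mult_left_mono[OF \<open>wS \<le> wT\<close>, of "m\<^sup>2"] \<epsilon> by (simp add: pos_le_divide_eq mult.commute)
        have sup_R: "cmod (f z) \<le> sqrt B * m" if z: "z \<in> ball a (R * s)" for z
        proof -
          \<comment> \<open>A disk of radius \<open>?q\<close> about \<open>z\<close> stays in
            \<open>T\<close>; the larger radius \<open>(1 - R) * s\<close> still stays in the unit
            disk and gives the room required for the mean value property.\<close>
          let ?q = "(\<rho> - R) * s"
          have q: "0 < ?q" "?q < (1 - R) * s" using r s by simp_all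
          have d: "dist a z < R * s" using z by simp
          have zq: "ball z ?q \<subseteq> ball a (\<rho> * s)"
          proof
            fix w assume "w \<in> ball z ?q"
            then have "dist z w < \<rho> * s - R * s" by (simp add: left_diff_distrib)
            with d show "w \<in> ball a (\<rho> * s)" using dist_triangle[of a w z] by simp
          qed
          have zd: "ball z ((1 - R) * s) \<subseteq> unit_disk"
            using d by (intro in_disk) (simp add: left_diff_distrib)
          have "ennreal (?q ^ 4 * (cmod (f z))\<^sup>2) * ennreal wT \<le> ennreal (K * (\<rho> * s) ^ 4) * ennreal jT"
            using harmonic_weighted_pointwise_bound[OF _ \<omega>(2) A2 _ a rs(7,5) _ hf zd q zq] K T_disk
            unfolding J_def[symmetric] T_def[symmetric] wT(2) jT(2) by simp
          then have "?q ^ 4 * (cmod (f z))\<^sup>2 * wT \<le> K * (\<rho> * s) ^ 4 * jT"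
            using K wT(1) jT(1) by (simp flip: ennreal_mult)
          also have "\<dots> \<le> K * (\<rho> * s) ^ 4 * (m\<^sup>2 * wT / \<epsilon>)"
            using K by (intro mult_left_mono jT_le) simp
          also have "\<dots> = ?q ^ 4 * (B * m\<^sup>2) * wT"
            using r s \<epsilon> by (simp add: B_def power_mult_distrib power_divide)
          finally have "(cmod (f z))\<^sup>2 \<le> B * m\<^sup>2"
            using q(1) \<open>0 < wT\<close>
            by (simp only: mult_le_cancel_right_pos mult_le_cancel_left_pos zero_less_power)
          also have "\<dots> = (sqrt B * m)\<^sup>2" using B by (simp add: power_mult_distrib)
          finally show ?thesis
            using B m by (intro power2_le_imp_le[of "cmod (f z)"]) simp_all
        qed
        \<comment> \<open>The supremum need not be attained on the open disk, so half of it is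
          used.\<close>
        have half: "\<exists>z\<in>ball a (r * s). m / 2 \<le> cmod (f z)"
        proof (rule ccontr)
          assume "\<not> ?thesis"
          then have "cmod (f z) \<le> m / 2" if "z \<in> S" for z
            using that by (auto simp: S_def not_le intro: less_imp_le)
          then have "m \<le> m / 2" using aS
            unfolding m_def by (intro cSUP_least) auto
          with m show False by simp
        qed
        define N where "N = {z \<in> S. cmod (f z) < \<eta> * m}"
        have "harmonic_on f (ball a (R * s))"
          by (intro harmonic_on_subset[OF hf open_ball] in_disk, unfold dist_self, use rs in linarith)
        from sublevel[OF this s(1) m sup_R half]
        have N_le: "measure lebesgue N \<le> \<delta> / 2 * (pi * r\<^sup>2) * s\<^sup>2"
          by (simp only: N_def S_def)
        have N_sets: "N \<in> sets disk_area"
        proof -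
          have "open {z \<in> S. \<bar>cmod (f z)\<bar> < \<eta> * m}"
            using S_disk by (intro open_sublevel continuous_on_norm continuous_on_subset[OF cf]) (simp_all add: S_def)
          then show ?thesis
            using S_disk by (intro open_in_sets_disk_area) (auto simp: N_def)
        qed
        have "measure disk_area N \<le> \<delta> / 2 * (r * s)\<^sup>2"
          using N_le by (simp add: measure_disk_area[OF N_sets] pos_divide_le_eq power_mult_distrib mult_ac)
        moreover have "\<delta> * (r * s)\<^sup>2 \<le> measure disk_area E"
          using \<delta>E measure_disk_area_ball[of a "r * s"] S_disk rs(1) by (simp add: S_def s_def)
        moreover have "measure disk_area E \<le> measure disk_area (E - N) + measure disk_area N"
        proof -
          have "measure disk_area E \<le> measure disk_area ((E - N) \<union> N)"
            using E N_sets by (intro finite_measure_mono) auto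
          also have "\<dots> \<le> measure disk_area (E - N) + measure disk_area N"
            using E N_sets by (intro measure_Un_le) auto
          finally show ?thesis .
        qed
        ultimately have EN: "\<delta> / 2 * (r * s)\<^sup>2 \<le> measure disk_area (E - N)" by linarith
        obtain wE where wE: "0 \<le> wE" "weighted_area \<omega> (E - N) = ennreal wE"
          using w_fin[of "E - N"] by (cases "weighted_area \<omega> (E - N)") auto
        have "ennreal ((measure disk_area (E - N))\<^sup>2) * ennreal wS \<le> ennreal (K * (r * s) ^ 4) * ennreal wE"
          using weighted_area_ge[OF _ \<omega>(2) A2 _ a rs(1,6), of "E - N"] K S_disk E N_sets ES'
          unfolding S_def[symmetric] wS(2) wE(2) by auto
        then have "(measure disk_area (E - N))\<^sup>2 * wS \<le> K * (r * s) ^ 4 * wE"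
          using K wS(1) wE(1) by (simp flip: ennreal_mult)
        moreover have "(\<delta> / 2 * (r * s)\<^sup>2)\<^sup>2 * wS \<le> (measure disk_area (E - N))\<^sup>2 * wS"
          using EN \<delta> wS(1) by (intro mult_right_mono power_mono) simp_all
        ultimately have "(\<delta> / 2 * (r * s)\<^sup>2)\<^sup>2 * wS \<le> K * (r * s) ^ 4 * wE" by linarith
        \<comment> \<open>Both sides carry the squared area of \<open>S\<close>; cancelling it makes
          the constant independent of \<open>s\<close>.\<close>
        moreover have "(\<delta> / 2 * (r * s)\<^sup>2)\<^sup>2 * wS = (r * s) ^ 4 * (\<delta>\<^sup>2 / 4 * wS)"
          by (simp add: power_mult_distrib power_divide flip: power_mult)
        moreover have "K * (r * s) ^ 4 * wE = (r * s) ^ 4 * (K * wE)" by simp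
        ultimately have "\<delta>\<^sup>2 / 4 * wS \<le> K * wE"
          using rs(1) by (simp only: mult_le_cancel_left_pos zero_less_power)
        then have "m\<^sup>2 * wS \<le> C * ((\<eta> * m)\<^sup>2 * wE)"
          using \<delta> \<eta> m by (simp add: C_def power_mult_distrib field_simps)
        have "J S \<le> ennreal (m\<^sup>2 * wS)" using JS wS by (simp add: ennreal_mult)
        also have "\<dots> \<le> ennreal (C * ((\<eta> * m)\<^sup>2 * wE))"
          by (rule ennreal_leI) fact
        also have "\<dots> = ennreal C * (ennreal ((\<eta> * m)\<^sup>2) * weighted_area \<omega> (E - N))"
          using C wE by (simp add: ennreal_mult)
        also have "ennreal ((\<eta> * m)\<^sup>2) * weighted_area \<omega> (E - N) =
            (\<integral>\<^sup>+z. ennreal ((\<eta> * m)\<^sup>2) * (ennreal (\<omega> z) * indicator (E - N) z) \<partial>disk_area)"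
          unfolding weighted_area_def using E N_sets
          by (intro nn_integral_cmult[symmetric] borel_measurable_times_ennreal borel_measurable_indicator) simp_all
        also have "\<dots> \<le> J (E - N)"
          unfolding J_def
        proof (rule nn_integral_mono_AE, use \<omega>(2) in eventually_elim)
          fix z assume z: "0 < \<omega> z"
          show "ennreal ((\<eta> * m)\<^sup>2) * (ennreal (\<omega> z) * indicator (E - N) z)
            \<le> ennreal ((cmod (f z))\<^sup>2 * \<omega> z) * indicator (E - N) z"
          proof (cases "z \<in> E - N")
            case True
            then have "\<eta> * m \<le> cmod (f z)" using ES' by (auto simp: N_def)
            then have "(\<eta> * m)\<^sup>2 * \<omega> z \<le> (cmod (f z))\<^sup>2 * \<omega> z"
              using z \<eta> m by (intro mult_right_mono power_mono) simp_all
            with z True show ?thesis by (simp add: ennreal_leI flip: ennreal_mult)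
          qed simp
        qed
        also have "J (E - N) \<le> J E" by (rule J_mono) blast
        finally have "J S \<le> ennreal C * J E" by (simp add: mult_left_mono)
        then show ?thesis by (rule order.trans) simp
      qed
      then show "(\<integral>\<^sup>+z\<in>ball a (r * (1 - cmod a)). ennreal ((cmod (f z))\<^sup>2 * \<omega> z) \<partial>disk_area)
       \<le> ennreal \<epsilon> * (\<integral>\<^sup>+z\<in>ball a (\<rho> * (1 - cmod a)). ennreal ((cmod (f z))\<^sup>2 * \<omega> z) \<partial>disk_area)
         + ennreal C * (\<integral>\<^sup>+z\<in>E. ennreal ((cmod (f z))\<^sup>2 * \<omega> z) \<partial>disk_area)"
        by (simp only: J_def S_def T_def s_def)
    qed
  qed
qed

section \<open>Integration over all Whitney disks\<close>

text \<open>The density of the hyperbolic area \<open>(1 - |a|)\<^sup>-\<^sup>2 dA(a)\<close>, for which all Whitney disks of a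
  given aperture \<open>t\<close> have comparable mass, restricted to those \<open>a\<close> with \<open>z \<in> S(a,t)\<close>.\<close>

definition whitney_kernel :: "real \<Rightarrow> complex \<Rightarrow> complex \<Rightarrow> ennreal" where
  "whitney_kernel t a z = (if cmod (z - a) < t * (1 - cmod a) then ennreal (1 / (1 - cmod a)\<^sup>2) else 0)"

lemma whitney_disk_eq_ball:
  assumes "a \<in> unit_disk" "t \<le> 1"
  shows "whitney_disk a t = ball a (t * (1 - cmod a))"
proof -
  have "cmod z < 1" if "cmod (z - a) < t * (1 - cmod a)" for z
  proof -
    have "t * (1 - cmod a) \<le> 1 * (1 - cmod a)" using assms by (intro mult_right_mono) simp_all
    with that norm_triangle_ineq2[of z a] show ?thesis by simp
  qed
  then show ?thesis by (auto simp: whitney_disk_def dist_norm norm_minus_commute)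
qed

text \<open>If the disk of \<open>a\<close> contains \<open>z\<close>, then
  \<open>1 - cmod a\<close> and \<open>1 - cmod z\<close> are comparable. Such \<open>a\<close> lie
  in a disk about \<open>z\<close> of radius proportional to \<open>1 - cmod z\<close>, and the
  density there is at most a multiple of its inverse square, so the dependence on \<open>z\<close>
  cancels.\<close>

lemma nn_integral_whitney_kernel_le:
  assumes t: "0 < t" "t < 1" and z: "z \<in> unit_disk"
  shows "(\<integral>\<^sup>+a. whitney_kernel t a z \<partial>disk_area) \<le> ennreal ((t * (1 + t) / (1 - t))\<^sup>2)"
proof -
  define d where "d = 1 - cmod z"
  have d: "0 < d" using z by (simp add: d_def)
  \<comment> \<open>Such \<open>a\<close> satisfy \<open>(1 - t) * (1 - cmod a) \<le> d\<close>,
    hence \<open>t * (1 - cmod a) \<le> q\<close>.\<close>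
  define q where "q = t * d / (1 - t)"
  have q: "0 < q" using t d by (simp add: q_def)
  have le: "whitney_kernel t a z \<le> ennreal ((1 + t)\<^sup>2 / d\<^sup>2) * indicator (ball z q \<inter> unit_disk) a"
    if a: "a \<in> unit_disk" for a
  proof (cases "cmod (z - a) < t * (1 - cmod a)")
    case True
    define e where "e = 1 - cmod a"
    have e: "0 < e" using a by (simp add: e_def)
    have za: "cmod (z - a) < t * e" using True by (simp add: e_def)
    have "d \<le> e + cmod (z - a)" "e \<le> d + cmod (z - a)"
      using norm_triangle_ineq2[of a z] norm_triangle_ineq2[of z a]
      by (auto simp: d_def e_def norm_minus_commute)
    with za have de: "d \<le> (1 + t) * e" "(1 - t) * e \<le> d" by (simp_all add: algebra_simps)
    have "t * ((1 - t) * e) \<le> t * d" using de(2) t by (intro mult_left_mono) simp_all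
    then have "t * e \<le> q" using t by (simp add: q_def pos_le_divide_eq mult_ac)
    with za a have ind: "a \<in> ball z q \<inter> unit_disk" by (simp add: dist_norm)
    have "d\<^sup>2 \<le> ((1 + t) * e)\<^sup>2" using de(1) d by (intro power_mono) simp_all
    then have "d\<^sup>2 \<le> (1 + t)\<^sup>2 * e\<^sup>2" by (simp only: power_mult_distrib)
    then have "1 / e\<^sup>2 \<le> (1 + t)\<^sup>2 / d\<^sup>2" using d e by (simp add: field_simps)
    with True ind show ?thesis by (simp add: whitney_kernel_def e_def ennreal_leI)
  qed (simp add: whitney_kernel_def)
  have sets: "ball z q \<inter> unit_disk \<in> sets disk_area" by (intro open_in_sets_disk_area) auto
  have "(\<integral>\<^sup>+a. whitney_kernel t a z \<partial>disk_area) \<le>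
      (\<integral>\<^sup>+a. ennreal ((1 + t)\<^sup>2 / d\<^sup>2) * indicator (ball z q \<inter> unit_disk) a \<partial>disk_area)"
    by (intro nn_integral_mono le) simp
  also have "\<dots> = ennreal ((1 + t)\<^sup>2 / d\<^sup>2) * emeasure disk_area (ball z q \<inter> unit_disk)"
    using sets by (rule nn_integral_cmult_indicator)
  also have "emeasure disk_area (ball z q \<inter> unit_disk) \<le> ennreal (pi * q\<^sup>2) / ennreal pi"
    unfolding emeasure_disk_area[OF sets]
    using emeasure_mono[of "ball z q \<inter> unit_disk" "ball z q" lebesgue] q
    by (intro divide_right_mono_ennreal) (simp add: emeasure_lborel_ball_complex)
  also have "ennreal (pi * q\<^sup>2) / ennreal pi = ennreal (q\<^sup>2)"
    by (simp add: divide_ennreal)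
  also have "ennreal ((1 + t)\<^sup>2 / d\<^sup>2) * ennreal (q\<^sup>2) = ennreal ((1 + t)\<^sup>2 / d\<^sup>2 * q\<^sup>2)"
    by (rule ennreal_mult[symmetric]) simp_all
  also have "(1 + t)\<^sup>2 / d\<^sup>2 * q\<^sup>2 = (t * (1 + t) / (1 - t))\<^sup>2"
    using d by (simp add: q_def power_mult_distrib power_divide)
  finally show ?thesis by (simp add: mult_left_mono)
qed

lemma nn_integral_whitney_kernel_ge:
  assumes t: "0 < t" and z: "z \<in> unit_disk"
  shows "ennreal ((t / (1 + 2 * t))\<^sup>2) \<le> (\<integral>\<^sup>+a. whitney_kernel t a z \<partial>disk_area)"
proof -
  define d where "d = 1 - cmod z"
  have d: "0 < d" using z by (simp add: d_def)
  \<comment> \<open>The solution of \<open>q = t * (d - q)\<close>: every \<open>a\<close> in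
    \<open>ball z q\<close> has \<open>1 - cmod a > d - q\<close>, so its disk of aperture
    \<open>t\<close> contains \<open>z\<close>. The density is at least the inverse square of
    \<open>d + q\<close>, and \<open>q / (d + q)\<close> equals \<open>t / (1 + 2 * t)\<close>,
    which is free of \<open>z\<close>.\<close>
  define q where "q = t * d / (1 + t)"
  have q: "0 < q" using t d by (simp add: q_def)
  have dq: "d - q = d / (1 + t)" "d + q = d * (1 + 2 * t) / (1 + t)"
    using t by (simp_all add: q_def field_simps)
  have "0 < d / (1 + t)" using t d by simp
  have sub: "ball z q \<subseteq> unit_disk"
  proof
    fix a assume "a \<in> ball z q"
    then have "cmod (a - z) < q" by (simp add: dist_norm norm_minus_commute)
    with dq(1) \<open>0 < d / (1 + t)\<close> norm_triangle_ineq2[of a z] show "a \<in> unit_disk"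
      by (simp add: d_def)
  qed
  have ge: "ennreal (((1 + t) / (d * (1 + 2 * t)))\<^sup>2) * indicator (ball z q) a \<le> whitney_kernel t a z" for a
  proof (cases "a \<in> ball z q")
    case True
    define e where "e = 1 - cmod a"
    have za: "cmod (z - a) < q" using True by (simp add: dist_norm)
    have "d - q < e" "e < d + q"
      using za norm_triangle_ineq2[of a z] norm_triangle_ineq2[of z a]
      by (auto simp: d_def e_def norm_minus_commute)
    then have e: "d / (1 + t) < e" "e < d * (1 + 2 * t) / (1 + t)" by (simp_all only: dq)
    then have "0 < e" using \<open>0 < d / (1 + t)\<close> by linarith
    have "t * (d / (1 + t)) < t * e" using e(1) t by (rule mult_strict_left_mono)
    then have kern: "cmod (z - a) < t * (1 - cmod a)" using za by (simp add: q_def e_def)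
    have "(1 + t) / (d * (1 + 2 * t)) = 1 / (d * (1 + 2 * t) / (1 + t))" by simp
    also have "\<dots> \<le> 1 / e" using e(2) \<open>0 < e\<close> by (intro frac_le) simp_all
    finally have "((1 + t) / (d * (1 + 2 * t)))\<^sup>2 \<le> (1 / e)\<^sup>2"
      using t d by (intro power_mono) simp_all
    with True kern show ?thesis
      by (simp add: whitney_kernel_def e_def ennreal_leI power_divide)
  qed simp
  interpret finite_measure disk_area by (rule finite_measure_disk_area)
  have "(t / (1 + 2 * t))\<^sup>2 = ((1 + t) / (d * (1 + 2 * t)) * q)\<^sup>2"
    using d t by (simp add: q_def)
  also have "\<dots> = ((1 + t) / (d * (1 + 2 * t)))\<^sup>2 * q\<^sup>2" by (simp only: power_mult_distrib)
  also have "ennreal \<dots> = ennreal (((1 + t) / (d * (1 + 2 * t)))\<^sup>2) * emeasure disk_area (ball z q)"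
    using q by (simp add: emeasure_eq_measure measure_disk_area_ball[OF sub] ennreal_mult)
  also have "\<dots> = (\<integral>\<^sup>+a. ennreal (((1 + t) / (d * (1 + 2 * t)))\<^sup>2) * indicator (ball z q) a \<partial>disk_area)"
    using sub by (intro nn_integral_cmult_indicator[symmetric] open_in_sets_disk_area) simp_all
  also have "\<dots> \<le> (\<integral>\<^sup>+a. whitney_kernel t a z \<partial>disk_area)"
    by (intro nn_integral_mono ge)
  finally show ?thesis .
qed

text \<open>Tonelli's theorem: for fixed \<open>z\<close>, the kernel is the density on those
  \<open>a\<close> whose disk contains \<open>z\<close>. The second claim is needed to split an
  integral of a sum over \<open>a\<close>.\<close>

lemma nn_integral_whitney_disks:
  fixes F :: "complex \<Rightarrow> ennreal"
  assumes [measurable]: "F \<in> borel_measurable disk_area"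
  shows "(\<integral>\<^sup>+a. ennreal (1 / (1 - cmod a)\<^sup>2) * (\<integral>\<^sup>+z\<in>ball a (t * (1 - cmod a)). F z \<partial>disk_area) \<partial>disk_area)
    = (\<integral>\<^sup>+z. F z * (\<integral>\<^sup>+a. whitney_kernel t a z \<partial>disk_area) \<partial>disk_area)" (is "?L = ?R")
    and "(\<lambda>a. ennreal (1 / (1 - cmod a)\<^sup>2) * (\<integral>\<^sup>+z\<in>ball a (t * (1 - cmod a)). F z \<partial>disk_area))
      \<in> borel_measurable disk_area"
proof -
  interpret finite_measure disk_area by (rule finite_measure_disk_area)
  interpret pair_sigma_finite disk_area disk_area ..
  have [measurable]: "(\<lambda>z. z) \<in> borel_measurable disk_area"
    by (intro borel_measurable_disk_area continuous_intros)
  have [measurable]: "fst \<in> borel_measurable (disk_area \<Otimes>\<^sub>M disk_area)"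
      "snd \<in> borel_measurable (disk_area \<Otimes>\<^sub>M disk_area)"
    by (rule measurable_compose[OF measurable_fst \<open>(\<lambda>z. z) \<in> borel_measurable disk_area\<close>])
       (rule measurable_compose[OF measurable_snd \<open>(\<lambda>z. z) \<in> borel_measurable disk_area\<close>])
  have kern[measurable]: "(\<lambda>(a, z). whitney_kernel t a z) \<in> borel_measurable (disk_area \<Otimes>\<^sub>M disk_area)"
    unfolding whitney_kernel_def case_prod_beta by measurable
  have F_snd: "(\<lambda>p. F (snd p)) \<in> borel_measurable (disk_area \<Otimes>\<^sub>M disk_area)"
    by (rule measurable_compose[OF measurable_snd assms])
  have meas: "(\<lambda>(a, z). F z * whitney_kernel t a z) \<in> borel_measurable (disk_area \<Otimes>\<^sub>M disk_area)"
    using borel_measurable_times_ennreal[OF F_snd kern] by (simp add: case_prod_beta)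
  have kern1: "(\<lambda>a. whitney_kernel t a z) \<in> borel_measurable disk_area" if "z \<in> unit_disk" for z
    using measurable_compose[OF measurable_Pair1'[of z disk_area disk_area] kern] that by simp
  have inner: "ennreal (1 / (1 - cmod a)\<^sup>2) * (\<integral>\<^sup>+z\<in>ball a (t * (1 - cmod a)). F z \<partial>disk_area)
      = (\<integral>\<^sup>+z. F z * whitney_kernel t a z \<partial>disk_area)" if "a \<in> unit_disk" for a
  proof -
    \<comment> \<open>The ball may leave the unit disk when \<open>t\<close> is large; intersecting
      it with the disk, which carries the measure, makes it measurable.\<close>
    have "ennreal (1 / (1 - cmod a)\<^sup>2) * (\<integral>\<^sup>+z\<in>ball a (t * (1 - cmod a)). F z \<partial>disk_area)
      = ennreal (1 / (1 - cmod a)\<^sup>2) * (\<integral>\<^sup>+z\<in>ball a (t * (1 - cmod a)) \<inter> unit_disk. F z \<partial>disk_area)"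
      by (intro arg_cong2[where f = "(*)"] refl nn_integral_cong) (simp add: indicator_def)
    also have "\<dots> = (\<integral>\<^sup>+z. ennreal (1 / (1 - cmod a)\<^sup>2) *
        (F z * indicator (ball a (t * (1 - cmod a)) \<inter> unit_disk) z) \<partial>disk_area)"
      by (intro nn_integral_cmult[symmetric] borel_measurable_times_ennreal assms
          borel_measurable_indicator open_in_sets_disk_area) auto
    also have "\<dots> = (\<integral>\<^sup>+z. F z * whitney_kernel t a z \<partial>disk_area)"
      by (intro nn_integral_cong)
         (auto simp: whitney_kernel_def indicator_def dist_norm norm_minus_commute mult.commute)
    finally show ?thesis .
  qed
  have "?L = (\<integral>\<^sup>+a. \<integral>\<^sup>+z. F z * whitney_kernel t a z \<partial>disk_area \<partial>disk_area)"
    by (intro nn_integral_cong inner) simp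
  also have "\<dots> = (\<integral>\<^sup>+z. \<integral>\<^sup>+a. F z * whitney_kernel t a z \<partial>disk_area \<partial>disk_area)"
    using Fubini[OF meas] by (simp add: case_prod_beta)
  also have "\<dots> = ?R"
    by (intro nn_integral_cong nn_integral_cmult kern1) simp
  finally show "?L = ?R" .
  have "(\<lambda>a. \<integral>\<^sup>+z. F z * whitney_kernel t a z \<partial>disk_area) \<in> borel_measurable disk_area"
    using sigma_finite_measure.borel_measurable_nn_integral_fst[OF
        finite_measure.axioms(1)[OF finite_measure_disk_area] meas] by simp
  then show "(\<lambda>a. ennreal (1 / (1 - cmod a)\<^sup>2) * (\<integral>\<^sup>+z\<in>ball a (t * (1 - cmod a)). F z \<partial>disk_area))
      \<in> borel_measurable disk_area"
    by (subst measurable_cong[OF inner]) simp_all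
qed

section \<open>Absorption of the small term\<close>

theorem theorem5p1:
  fixes \<omega> :: "complex \<Rightarrow> real" and \<delta> r :: real
  assumes "A2_weight \<omega>" and "0 < \<delta>" "\<delta> < 1" and "0 < r" "r < 1"
  shows "\<exists>C::real. 0 < C \<and>
    (\<forall>G\<in>sets disk_area.
       (\<forall>a\<in>unit_disk. measure disk_area (G \<inter> whitney_disk a r) \<ge> \<delta> * measure disk_area (whitney_disk a r)) \<longrightarrow>
       (\<forall>f\<in>L2h \<omega>.
          (\<integral>\<^sup>+z. ennreal ((cmod (f z))\<^sup>2 * \<omega> z) \<partial>disk_area)
            \<le> ennreal C * (\<integral>\<^sup>+z\<in>G. ennreal ((cmod (f z))\<^sup>2 * \<omega> z) \<partial>disk_area)))"
proof -
  have \<omega>: "integrable disk_area \<omega>" "AE z in disk_area. 0 < \<omega> z" "A2_characteristic \<omega> < \<infinity>"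
    using assms(1) by (auto simp: A2_weight_def)
  \<comment> \<open>The added 1 makes \<open>K\<close> positive without a lower bound for the
    characteristic.\<close>
  define K where "K = enn2real (A2_characteristic \<omega>) + 1"
  have K: "0 < K" by (simp add: K_def add_nonneg_pos)
  have "A2_characteristic \<omega> = ennreal (enn2real (A2_characteristic \<omega>))"
    using \<omega>(3) by simp
  also have "\<dots> \<le> ennreal K" by (intro ennreal_leI) (simp add: K_def)
  finally have A2: "A2_characteristic \<omega> \<le> ennreal K" .
  obtain \<rho> where \<rho>: "r < \<rho>" "\<rho> < 1" using dense[OF assms(5)] by blast
  obtain R where R: "r < R" "R < \<rho>" using dense[OF \<rho>(1)] by blast
  \<comment> \<open>\<open>n\<close> and \<open>N t\<close> are the lower bound (for aperture
    \<open>r\<close>) and the upper bound (for aperture \<open>t\<close>) of the integrated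
    kernel.\<close>
  define n where "n = (r / (1 + 2 * r))\<^sup>2"
  define N where "N t = (t * (1 + t) / (1 - t))\<^sup>2" for t :: real
  have n: "0 < n" using assms(4) by (simp add: n_def)
  have N: "0 < N t" if "0 < t" "t < 1" for t using that by (simp add: N_def)
  have N\<rho>: "0 < N \<rho>" and Nr: "0 < N r" using N \<rho> assms(4,5) by simp_all
  \<comment> \<open>Chosen so that \<open>\<epsilon> * N \<rho> = n / 2\<close>: the first term on
    the right then takes up half of the left side.\<close>
  define \<epsilon> where "\<epsilon> = n / (2 * N \<rho>)"
  have \<epsilon>: "0 < \<epsilon>" using n N\<rho> by (simp add: \<epsilon>_def)
  show ?thesis
  proof (rule local_estimate[OF \<omega>(1,2) A2 K assms(4) R \<rho>(2) assms(2) \<epsilon>])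
    fix C
    assume C: "0 < C"
      and loc: "\<And>f a E. \<lbrakk>f \<in> L2h \<omega>; a \<in> unit_disk; E \<in> sets disk_area; E \<subseteq> ball a (r * (1 - cmod a));
       \<delta> * measure disk_area (ball a (r * (1 - cmod a))) \<le> measure disk_area E\<rbrakk>
     \<Longrightarrow> (\<integral>\<^sup>+z\<in>ball a (r * (1 - cmod a)). ennreal ((cmod (f z))\<^sup>2 * \<omega> z) \<partial>disk_area)
       \<le> ennreal \<epsilon> * (\<integral>\<^sup>+z\<in>ball a (\<rho> * (1 - cmod a)). ennreal ((cmod (f z))\<^sup>2 * \<omega> z) \<partial>disk_area)
         + ennreal C * (\<integral>\<^sup>+z\<in>E. ennreal ((cmod (f z))\<^sup>2 * \<omega> z) \<partial>disk_area)"
    show ?thesis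
    proof (intro exI[of _ "2 * C * N r / n"] conjI ballI impI)
      show "0 < 2 * C * N r / n" using C Nr n by simp
      fix G f
      assume G: "G \<in> sets disk_area"
        and dens: "\<forall>a\<in>unit_disk. measure disk_area (G \<inter> whitney_disk a r) \<ge> \<delta> * measure disk_area (whitney_disk a r)"
        and f: "f \<in> L2h \<omega>"
      define F where "F z = ennreal ((cmod (f z))\<^sup>2 * \<omega> z)" for z
      have f_meas: "f \<in> borel_measurable disk_area"
        using f by (intro borel_measurable_disk_area harmonic_on_imp_continuous_on) (simp add: L2h_def)
      have F: "F \<in> borel_measurable disk_area"
        unfolding F_def using f_meas borel_measurable_integrable[OF \<omega>(1)] by measurable
      have FG: "(\<lambda>z. F z * indicator G z) \<in> borel_measurable disk_area"
        using F G by (intro borel_measurable_times_ennreal borel_measurable_indicator)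
      define w where "w a = ennreal (1 / (1 - cmod a)\<^sup>2)" for a :: complex
      define J where "J t H = (\<integral>\<^sup>+a. w a * (\<integral>\<^sup>+z\<in>ball a (t * (1 - cmod a)). H z \<partial>disk_area) \<partial>disk_area)"
        for t and H :: "complex \<Rightarrow> ennreal"
      have J_le: "J t H \<le> ennreal (N t) * (\<integral>\<^sup>+z. H z \<partial>disk_area)"
        if t: "0 < t" "t < 1" and H: "H \<in> borel_measurable disk_area" for t H
      proof -
        have "J t H \<le> (\<integral>\<^sup>+z. ennreal (N t) * H z \<partial>disk_area)"
          unfolding J_def w_def nn_integral_whitney_disks(1)[OF H] N_def
          by (intro nn_integral_mono) (simp add: mult.commute mult_left_mono nn_integral_whitney_kernel_le[OF t])
        with nn_integral_cmult[OF H] show ?thesis by simp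
      qed
      have J_ge: "ennreal n * (\<integral>\<^sup>+z. F z \<partial>disk_area) \<le> J r F"
      proof -
        have "ennreal n * (\<integral>\<^sup>+z. F z \<partial>disk_area) = (\<integral>\<^sup>+z. ennreal n * F z \<partial>disk_area)"
          using F by (rule nn_integral_cmult[symmetric])
        also have "\<dots> \<le> J r F"
          unfolding J_def w_def nn_integral_whitney_disks(1)[OF F] n_def
          by (intro nn_integral_mono, subst mult.commute)
             (intro mult_left_mono nn_integral_whitney_kernel_ge[OF assms(4)], simp_all)
        finally show ?thesis .
      qed
      have loc': "(\<integral>\<^sup>+z\<in>ball a (r * (1 - cmod a)). F z \<partial>disk_area)
          \<le> ennreal \<epsilon> * (\<integral>\<^sup>+z\<in>ball a (\<rho> * (1 - cmod a)). F z \<partial>disk_area)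
            + ennreal C * (\<integral>\<^sup>+z\<in>ball a (r * (1 - cmod a)). F z * indicator G z \<partial>disk_area)"
        if a: "a \<in> unit_disk" for a
      proof -
        have eq: "whitney_disk a r = ball a (r * (1 - cmod a))"
          using a assms(5) by (intro whitney_disk_eq_ball) simp_all
        have "ball a (r * (1 - cmod a)) \<subseteq> unit_disk"
          unfolding eq[symmetric] by (auto simp: whitney_disk_def)
        then have "G \<inter> ball a (r * (1 - cmod a)) \<in> sets disk_area"
          by (intro sets.Int[OF G] open_in_sets_disk_area open_ball)
        moreover have "\<delta> * measure disk_area (ball a (r * (1 - cmod a)))
            \<le> measure disk_area (G \<inter> ball a (r * (1 - cmod a)))"
          using dens a unfolding eq[symmetric] by blast
        ultimately have "(\<integral>\<^sup>+z\<in>ball a (r * (1 - cmod a)). F z \<partial>disk_area)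
          \<le> ennreal \<epsilon> * (\<integral>\<^sup>+z\<in>ball a (\<rho> * (1 - cmod a)). F z \<partial>disk_area)
            + ennreal C * (\<integral>\<^sup>+z\<in>G \<inter> ball a (r * (1 - cmod a)). F z \<partial>disk_area)"
          unfolding F_def by (intro loc f a) simp_all
        also have "(\<integral>\<^sup>+z\<in>G \<inter> ball a (r * (1 - cmod a)). F z \<partial>disk_area) =
            (\<integral>\<^sup>+z\<in>ball a (r * (1 - cmod a)). F z * indicator G z \<partial>disk_area)"
          by (intro nn_integral_cong) (simp add: indicator_inter_arith mult.assoc)
        finally show ?thesis .
      qed
      have "J r F \<le> (\<integral>\<^sup>+a. ennreal \<epsilon> * (w a * (\<integral>\<^sup>+z\<in>ball a (\<rho> * (1 - cmod a)). F z \<partial>disk_area))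
          + ennreal C * (w a * (\<integral>\<^sup>+z\<in>ball a (r * (1 - cmod a)). F z * indicator G z \<partial>disk_area)) \<partial>disk_area)"
        unfolding J_def
      proof (rule nn_integral_mono)
        fix a assume "a \<in> space disk_area"
        then have "a \<in> unit_disk" by simp
        from mult_left_mono[OF loc'[OF this], of "w a"]
        show "w a * (\<integral>\<^sup>+z\<in>ball a (r * (1 - cmod a)). F z \<partial>disk_area)
          \<le> ennreal \<epsilon> * (w a * (\<integral>\<^sup>+z\<in>ball a (\<rho> * (1 - cmod a)). F z \<partial>disk_area))
            + ennreal C * (w a * (\<integral>\<^sup>+z\<in>ball a (r * (1 - cmod a)). F z * indicator G z \<partial>disk_area))"
          by (simp only: distrib_left mult.left_commute zero_le)
      qed
      \<comment> \<open>Additivity rests on the measurability in \<open>a\<close> of both averaged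
        integrals.\<close>
      also have "\<dots> = ennreal \<epsilon> * J \<rho> F + ennreal C * J r (\<lambda>z. F z * indicator G z)"
        unfolding J_def w_def
        using nn_integral_whitney_disks(2)[OF F, of \<rho>] nn_integral_whitney_disks(2)[OF FG, of r]
        by (subst nn_integral_add) (simp_all add: nn_integral_cmult)
      also have "\<dots> \<le> ennreal \<epsilon> * (ennreal (N \<rho>) * (\<integral>\<^sup>+z. F z \<partial>disk_area))
          + ennreal C * (ennreal (N r) * (\<integral>\<^sup>+z\<in>G. F z \<partial>disk_area))"
        using \<rho> assms(4,5) by (intro add_mono mult_left_mono J_le F FG) simp_all
      finally have main: "ennreal n * (\<integral>\<^sup>+z. F z \<partial>disk_area) \<le>
          ennreal \<epsilon> * (ennreal (N \<rho>) * (\<integral>\<^sup>+z. F z \<partial>disk_area))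
          + ennreal C * (ennreal (N r) * (\<integral>\<^sup>+z\<in>G. F z \<partial>disk_area))"
        using J_ge by (rule order.trans[rotated])
      \<comment> \<open>Absorption subtracts a multiple of the whole integral, which is legitimate
        because membership in \<open>L2h \<omega>\<close> makes it finite.\<close>
      have x_fin: "(\<integral>\<^sup>+z. F z \<partial>disk_area) < \<infinity>" using f by (simp add: L2h_def F_def)
      then obtain x where x: "0 \<le> x" "(\<integral>\<^sup>+z. F z \<partial>disk_area) = ennreal x"
        by (cases "\<integral>\<^sup>+z. F z \<partial>disk_area") auto
      have "(\<integral>\<^sup>+z\<in>G. F z \<partial>disk_area) \<le> (\<integral>\<^sup>+z. F z \<partial>disk_area)"
        by (intro nn_integral_mono) (simp add: indicator_def)
      then have "(\<integral>\<^sup>+z\<in>G. F z \<partial>disk_area) < \<infinity>" using x_fin by (rule le_less_trans)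
      then obtain y where y: "0 \<le> y" "(\<integral>\<^sup>+z\<in>G. F z \<partial>disk_area) = ennreal y"
        by (cases "\<integral>\<^sup>+z\<in>G. F z \<partial>disk_area") auto
      have "ennreal (n * x) \<le> ennreal (\<epsilon> * (N \<rho> * x) + C * (N r * y))"
        using main n \<epsilon> C N\<rho> Nr x y by (simp add: ennreal_mult ennreal_plus)
      then have "n * x \<le> \<epsilon> * (N \<rho> * x) + C * (N r * y)"
        using \<epsilon> C N\<rho> Nr x(1) y(1) by (subst (asm) ennreal_le_iff) simp_all
      also have "\<epsilon> * (N \<rho> * x) = n / 2 * x" using N\<rho> by (simp add: \<epsilon>_def)
      finally have "x \<le> 2 * C * N r / n * y" using n by (simp add: field_simps)
      then have "ennreal x \<le> ennreal (2 * C * N r / n) * ennreal y"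
        using C Nr n y(1) by (simp add: ennreal_leI flip: ennreal_mult)
      then show "(\<integral>\<^sup>+z. ennreal ((cmod (f z))\<^sup>2 * \<omega> z) \<partial>disk_area)
          \<le> ennreal (2 * C * N r / n) * (\<integral>\<^sup>+z\<in>G. ennreal ((cmod (f z))\<^sup>2 * \<omega> z) \<partial>disk_area)"
        unfolding x(2)[symmetric] y(2)[symmetric] F_def .
    qed
  qed
qed

end
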